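(* Let $w$, $\boldsymbol F: X\to X$, $X_0$, $\boldsymbol z^{(1)},\dots,\boldsymbol z^{(p)}$, $\boldsymbol\omega$, $\mu$, $\tilde{\boldsymbol h}$ satisfy hypotheses H1, H2 and H3 of the context (torus dimension $d$, smoothness $M$, island period $p\ge 1$, Diophantine exponent $\nu$). Let $m$ and $C_m$ be identical to those of the weighted Birkhoff average theorem recalled in the context; that is, $m>1$ is an integer with $M>d+m\nu$, and $C_m$ is the constant of that theorem, for which $$\Big|\mathcal{WB}_{N}[\tilde{\boldsymbol h}](\boldsymbol x)-\int_{X_0}\tilde{\boldsymbol h}\,d\mu\Big|\le C_m N^{-m}$$ with $C_m$ independent of $\boldsymbol x\in X_0$. Then the residual $R^2$ of the Birkhoff RRE least-squares problem defined in the context (with initial point $\boldsymbol x_0\in X_0$, parameters $K,T$ and regularization $\epsilon\ge0$) converges, independently of how $T$ depends on $K$, as $$\epsilon \;\le\; R^2 \;\le\; \epsilon + C_m\,(2K)^{-2m},$$ with this same $m$ and this same constant $C_m$.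
   Context: Notation: $\mathbb T=\mathbb R/\mathbb Z$; $R_\omega:\mathbb T^d\to\mathbb T^d$, $R_\omega(\boldsymbol\theta)=\boldsymbol\theta+\boldsymbol\omega$; $M$ is a positive integer or $\infty$. Hypotheses. H1 (smooth bump function): $w\in C^\infty(\mathbb R)$ has compact support on $[0,1]$ and $w(x)>0$ for all $x\in(0,1)$. H2 (Diophantine): $\boldsymbol\omega$ is a rotation vector satisfying a $(c,\nu)$ Diophantine condition: $|\boldsymbol\omega\cdot\boldsymbol n-\ell|\ge c\,\|\boldsymbol n\|^{-\nu}$ for all $\boldsymbol n\in\mathbb Z^d\setminus\{0\}$ and $\ell\in\mathbb Z$. H3 (smooth system): $X$ is a $C^M$ manifold and $\boldsymbol F:X\to X$ is $C^M$. $X_0\subseteq X$ is a set on which $\boldsymbol F$ is conjugate to island dynamics with rotation vector $\boldsymbol\omega$, invariant measure $\mu$ and period $p\ge1$: there are maps $\boldsymbol z^{(j)}:\mathbb T^d\to X$ in $C^M$, $1\le j\le p$, whose images make up $X_0$, with $\boldsymbol F\circ\boldsymbol z^{(j)}=\boldsymbol z^{(j+1)}$ for $1\le j<p$ and $\boldsymbol F\circ \boldsymbol z^{(p)}=\boldsymbol z^{(1)}\circ R_\omega$. The observable $\tilde{\boldsymbol h}:X\to\mathbb R^D$ is $C^M$. (The case $p=1$ is an invariant torus.) Weights and weighted Birkhoff average. For a positive integer $N$ and $0\le k\le N-1$, $$w_{k,N}=\Big(\sum_{j=0}^{N-1}w\big(\tfrac{j+1}{N+1}\big)\Big)^{-1}w\big(\tfrac{k+1}{N+1}\big),\qquad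 \mathcal{WB}_N[\tilde{\boldsymbol h}](\boldsymbol x)=\sum_{k=0}^{N-1}w_{k,N}\,\tilde{\boldsymbol h}(\boldsymbol F^k(\boldsymbol x)).$$ Weighted Birkhoff average theorem (Das and Yorke, extended to islands). Let $m>1$ be an integer. Under H1, H2, H3, there is a constant $C_m$ depending on $w,\tilde{\boldsymbol h},m,M,\nu,p$ but independent of $\boldsymbol x\in X_0$ such that $\big|\mathcal{WB}_N[\tilde{\boldsymbol h}](\boldsymbol x)-\int_{X_0}\tilde{\boldsymbol h}\,d\mu\big|\le C_mN^{-m}$, provided $M>d+m\nu$. The Birkhoff RRE least-squares problem. Given $\boldsymbol x_0\in X_0$, positive integers $K,T$ and $\epsilon\ge0$, put $\boldsymbol a_t=\tilde{\boldsymbol h}(\boldsymbol F^t(\boldsymbol x_0))$ and $\boldsymbol u_t=\boldsymbol a_{t+1}-\boldsymbol a_t\in\mathbb R^D$ for $0\le t\le T-1+2K$. Let $U\in\mathbb R^{TD\times(2K+1)}$ be the block Hankel matrix whose $(t,k)$ block is $\boldsymbol u_{t+k}$ ($0\le t\le T-1$, $0\le k\le 2K$). Let $W_T\in\mathbb R^{TD\times TD}$ be block diagonal with blocks $w_{t,T}I_D$, $0\le t\le T-1$. Let $W_K\in\mathbb R^{(2K+1)\times(2K+1)}$ be diagonal with entries $(W_K)_{kk}=\tfrac12\,(w_{k,2K+1}+w_{2K-k,2K+1})$, $0\le k\le 2K$. Then $$R^2=\min_{\boldsymbol c}\ \left\|\begin{pmatrix}W_T^{1/2}U\\ \epsilon^{1/2}W_K^{-1/2}\end{pmatrix}\boldsymbol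 c\right\|^2,$$ the minimum being over $\boldsymbol c=(c_0,\dots,c_{2K})\in\mathbb R^{2K+1}$ with $\sum_{k=0}^{2K}c_k=1$ and $c_{K+k}-c_{K-k}=0$ for $1\le k\le K$.
   Formalization: "This same constant C_m" is read as: there is one constant C_m, independent of x, N, x_0, K, T and ε, for which both the weighted Birkhoff bound and the residual bound hold; for an arbitrary or least C_m of the Birkhoff bound the claim fails, since rescaling h scales R² quadratically. *)

theory Defs
  imports "HOL-Analysis.Analysis"
begin

section \<open>Functions, manifolds and maps of class \<open>C\<^sup>k\<close>\<close>

text \<open>Used for open \<open>S\<close> only. The successor case asks that all directional
  derivatives are of class \<open>C\<^sup>n\<close>; on a finite-dimensional space this is the
  same as asking it of the derivative as an operator-valued map.\<close>

primrec Cn_on :: "nat \<Rightarrow> 'a::euclidean_space set \<Rightarrow> ('a \<Rightarrow> 'b::real_normed_vector) \<Rightarrow> bool" where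
  "Cn_on 0 S f \<longleftrightarrow> continuous_on S f"
| "Cn_on (Suc n) S f \<longleftrightarrow> (\<forall>x\<in>S. f differentiable (at x)) \<and>
     (\<forall>v. Cn_on n S (\<lambda>x. frechet_derivative f (at x) v))"

definition Ck_on :: "enat \<Rightarrow> 'a::euclidean_space set \<Rightarrow> ('a \<Rightarrow> 'b::real_normed_vector) \<Rightarrow> bool" where
  "Ck_on k S f \<longleftrightarrow> (\<forall>n. enat n \<le> k \<longrightarrow> Cn_on n S f)"

type_synonym ('x, 'e) chart = "'x set \<times> ('x \<Rightarrow> 'e)"

definition is_chart :: "'x topology \<Rightarrow> ('x, 'e::euclidean_space) chart \<Rightarrow> bool" where
  "is_chart X = (\<lambda>(U, \<phi>). openin X U \<and> open (\<phi> ` U) \<and>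
     homeomorphic_map (subtopology X U) (top_of_set (\<phi> ` U)) \<phi>)"

definition Ck_manifold :: "enat \<Rightarrow> 'x topology \<Rightarrow> ('x, 'e::euclidean_space) chart set \<Rightarrow> bool" where
  "Ck_manifold k X A \<longleftrightarrow>
     Hausdorff_space X \<and> second_countable X \<and>
     (\<forall>a\<in>A. is_chart X a) \<and>
     (\<Union>(U, \<phi>)\<in>A. U) = topspace X \<and>
     (\<forall>(U, \<phi>)\<in>A. \<forall>(V, \<psi>)\<in>A. Ck_on k (\<phi> ` (U \<inter> V)) (\<psi> \<circ> inv_into U \<phi>))"

definition Ck_map :: "enat \<Rightarrow> 'x topology \<Rightarrow> ('x, 'e::euclidean_space) chart set \<Rightarrow>
    'y topology \<Rightarrow> ('y, 'f::euclidean_space) chart set \<Rightarrow> ('x \<Rightarrow> 'y) \<Rightarrow> bool" where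
  "Ck_map k X A Y B f \<longleftrightarrow>
     continuous_map X Y f \<and>
     (\<forall>(U, \<phi>)\<in>A. \<forall>(V, \<psi>)\<in>B. Ck_on k (\<phi> ` (U \<inter> f -` V)) (\<psi> \<circ> f \<circ> inv_into U \<phi>))"

definition std_atlas :: "('e, 'e::euclidean_space) chart set" where
  "std_atlas = {(UNIV, \<lambda>x. x)}"

section \<open>Hypotheses\<close>

definition smooth_bump :: "(real \<Rightarrow> real) \<Rightarrow> bool" where
  "smooth_bump w \<longleftrightarrow> Ck_on \<infinity> UNIV w \<and> (\<forall>x. x \<notin> {0..1} \<longrightarrow> w x = 0) \<and> (\<forall>x\<in>{0<..<1}. 0 < w x)"

definition int_vec :: "int ^ 'd \<Rightarrow> real ^ 'd" where
  "int_vec n = (\<chi> i. of_int (n $ i))"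

definition diophantine :: "real \<Rightarrow> real \<Rightarrow> real ^ 'd \<Rightarrow> bool" where
  "diophantine c \<nu> \<omega> \<longleftrightarrow> 0 < c \<and>
     (\<forall>n l. n \<noteq> 0 \<longrightarrow> \<bar>\<omega> \<bullet> int_vec n - of_int l\<bar> \<ge> c * norm (int_vec n) powr (- \<nu>))"

definition borel_of :: "'x topology \<Rightarrow> 'x measure" where
  "borel_of X = sigma (topspace X) {U. openin X U}"

definition invariant_prob :: "'x topology \<Rightarrow> ('x \<Rightarrow> 'x) \<Rightarrow> 'x set \<Rightarrow> 'x measure \<Rightarrow> bool" where
  "invariant_prob X F X\<^sub>0 \<mu> \<longleftrightarrow>
     sets \<mu> = sets (borel_of X) \<and> emeasure \<mu> (space \<mu>) = 1 \<and> emeasure \<mu> X\<^sub>0 = 1 \<and> distr \<mu> \<mu> F = \<mu>"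

text \<open>A map on the torus \<open>\<real>\<^sup>d/\<int>\<^sup>d\<close> is given by its lift, a \<open>\<int>\<^sup>d\<close>-periodic map on
  \<open>\<real>\<^sup>d\<close>; the quotient map is a local diffeomorphism, so the lift has the same smoothness,
  and the rotation by \<open>\<omega>\<close> lifts to the translation by \<open>\<omega>\<close>.\<close>

definition torus_Ck_map :: "enat \<Rightarrow> 'x topology \<Rightarrow> ('x, 'e::euclidean_space) chart set \<Rightarrow>
    (real ^ 'd \<Rightarrow> 'x) \<Rightarrow> bool" where
  "torus_Ck_map k X A z \<longleftrightarrow>
     Ck_map k euclidean std_atlas X A z \<and> (\<forall>\<theta> n. z (\<theta> + int_vec n) = z \<theta>)"

definition island_dynamics :: "enat \<Rightarrow> 'x topology \<Rightarrow> ('x, 'e::euclidean_space) chart set \<Rightarrow>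
    ('x \<Rightarrow> 'x) \<Rightarrow> 'x set \<Rightarrow> real ^ 'd \<Rightarrow> 'x measure \<Rightarrow> nat \<Rightarrow> (nat \<Rightarrow> real ^ 'd \<Rightarrow> 'x) \<Rightarrow> bool" where
  "island_dynamics k X A F X\<^sub>0 \<omega> \<mu> p z \<longleftrightarrow>
     1 \<le> p \<and>
     (\<forall>j\<in>{1..p}. torus_Ck_map k X A (z j)) \<and>
     X\<^sub>0 = (\<Union>j\<in>{1..p}. range (z j)) \<and>
     (\<forall>j\<in>{1..<p}. \<forall>\<theta>. F (z j \<theta>) = z (j + 1) \<theta>) \<and>
     (\<forall>\<theta>. F (z p \<theta>) = z 1 (\<theta> + \<omega>)) \<and>
     invariant_prob X F X\<^sub>0 \<mu>"

section \<open>Weighted Birkhoff averages\<close>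

definition bump_weight :: "(real \<Rightarrow> real) \<Rightarrow> nat \<Rightarrow> nat \<Rightarrow> real" where
  "bump_weight w N k =
     inverse (\<Sum>j<N. w (real (j + 1) / real (N + 1))) * w (real (k + 1) / real (N + 1))"

definition WB :: "(real \<Rightarrow> real) \<Rightarrow> ('x \<Rightarrow> 'x) \<Rightarrow> nat \<Rightarrow> ('x \<Rightarrow> 'v::real_vector) \<Rightarrow> 'x \<Rightarrow> 'v" where
  "WB w F N h x = (\<Sum>k<N. bump_weight w N k *\<^sub>R h ((F ^^ k) x))"

section \<open>The Birkhoff RRE least-squares problem\<close>

text \<open>A matrix is a function of a row and a column index, restricted to finite index sets.
  The \<open>TD\<close> rows of \<open>U\<close> are indexed by pairs \<open>(t, i)\<close>, where \<open>i\<close> is a component of \<open>\<real>\<^sup>D\<close>,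
  and the rows of the stacked matrix by the disjoint sum of the row indices of its two parts.\<close>

type_synonym ('r, 'c) rmat = "'r \<Rightarrow> 'c \<Rightarrow> real"

definition rmat_mult :: "'k set \<Rightarrow> ('r, 'k) rmat \<Rightarrow> ('k, 'c) rmat \<Rightarrow> ('r, 'c) rmat" where
  "rmat_mult J A B = (\<lambda>i k. \<Sum>j\<in>J. A i j * B j k)"

text \<open>Real powers of a diagonal matrix with nonnegative entries.\<close>

definition diag_powr :: "('r, 'r) rmat \<Rightarrow> real \<Rightarrow> ('r, 'r) rmat" where
  "diag_powr A s = (\<lambda>i j. if i = j then A i i powr s else 0)"

definition rre_diff :: "('x \<Rightarrow> 'x) \<Rightarrow> ('x \<Rightarrow> real ^ 'D) \<Rightarrow> 'x \<Rightarrow> nat \<Rightarrow> real ^ 'D" where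
  "rre_diff F h x\<^sub>0 t = h ((F ^^ (t + 1)) x\<^sub>0) - h ((F ^^ t) x\<^sub>0)"

definition rre_U :: "('x \<Rightarrow> 'x) \<Rightarrow> ('x \<Rightarrow> real ^ 'D) \<Rightarrow> 'x \<Rightarrow> (nat \<times> 'D, nat) rmat" where
  "rre_U F h x\<^sub>0 = (\<lambda>(t, i) k. rre_diff F h x\<^sub>0 (t + k) $ i)"

definition rre_WT :: "(real \<Rightarrow> real) \<Rightarrow> nat \<Rightarrow> (nat \<times> 'D, nat \<times> 'D) rmat" where
  "rre_WT w T = (\<lambda>(t, i) (s, j). if (t, i) = (s, j) then bump_weight w T t else 0)"

definition rre_WK :: "(real \<Rightarrow> real) \<Rightarrow> nat \<Rightarrow> (nat, nat) rmat" where
  "rre_WK w K = (\<lambda>k l. if k = l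
     then (bump_weight w (2 * K + 1) k + bump_weight w (2 * K + 1) (2 * K - k)) / 2 else 0)"

definition rre_matrix :: "(real \<Rightarrow> real) \<Rightarrow> ('x \<Rightarrow> 'x) \<Rightarrow> ('x \<Rightarrow> real ^ 'D) \<Rightarrow> 'x \<Rightarrow>
    nat \<Rightarrow> nat \<Rightarrow> real \<Rightarrow> ((nat \<times> 'D) + nat, nat) rmat" where
  "rre_matrix w F h x\<^sub>0 K T \<epsilon> = case_sum
     (rmat_mult ({..<T} \<times> UNIV) (diag_powr (rre_WT w T) (1/2)) (rre_U F h x\<^sub>0))
     (\<lambda>k l. \<epsilon> powr (1/2) * diag_powr (rre_WK w K) (-1/2) k l)"

definition rre_objective :: "(real \<Rightarrow> real) \<Rightarrow> ('x \<Rightarrow> 'x) \<Rightarrow> ('x \<Rightarrow> real ^ 'D) \<Rightarrow> 'x \<Rightarrow>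
    nat \<Rightarrow> nat \<Rightarrow> real \<Rightarrow> (nat \<Rightarrow> real) \<Rightarrow> real" where
  "rre_objective w F h x\<^sub>0 K T \<epsilon> c =
     (\<Sum>r\<in>({..<T} \<times> UNIV) <+> {..2 * K}. (\<Sum>k\<le>2 * K. rre_matrix w F h x\<^sub>0 K T \<epsilon> r k * c k)\<^sup>2)"

definition rre_feasible :: "nat \<Rightarrow> (nat \<Rightarrow> real) set" where
  "rre_feasible K = {c. (\<Sum>k\<le>2 * K. c k) = 1 \<and> (\<forall>k\<in>{1..K}. c (K + k) - c (K - k) = 0)}"

definition rre_residual_sq :: "(real \<Rightarrow> real) \<Rightarrow> ('x \<Rightarrow> 'x) \<Rightarrow> ('x \<Rightarrow> real ^ 'D) \<Rightarrow> 'x \<Rightarrow>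
    nat \<Rightarrow> nat \<Rightarrow> real \<Rightarrow> real" where
  "rre_residual_sq w F h x\<^sub>0 K T \<epsilon> = (LEAST r. r \<in> rre_objective w F h x\<^sub>0 K T \<epsilon> ` rre_feasible K)"

end

theory Submission
  imports Defs
begin

text \<open>
  Composed with the island maps, the observable becomes finitely many \<open>C\<^sup>k\<close> functions on the torus.
  Their Fourier coefficients decay like \<open>\<parallel>n\<parallel>\<^sup>-\<^sup>k\<close>, while a bump-weighted exponential sum of frequency
  \<open>\<alpha>\<close> is \<open>O((N dist(\<alpha>, \<int>))\<^sup>-\<^sup>m)\<close> by \<open>m\<close> summations by parts. Along an island orbit the \<open>n\<close>-th mode has the
  frequencies \<open>(\<omega> \<bullet> n + r) / p\<close>, \<open>r < p\<close>, so the Diophantine condition and \<open>k > d + m \<nu>\<close> give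
  convergence of the weighted averages at rate \<open>N\<^sup>-\<^sup>m\<close> to a constant. Since
  \<open>\<mu>\<close> is invariant, the averages have the same integral as the observable, which identifies this constant.

  For the least-squares problem the test vector \<open>c\<^sub>k = (W\<^sub>K)\<^sub>k\<^sub>k\<close> consists of the weights of the symmetrised
  bump function \<open>(w(x) + w(1 - x)) / 2\<close>. Its penalty is exactly \<open>\<epsilon>\<close>, and \<open>U c\<close> is a difference of two weighted
  averages, each close to the same integral. That the penalty is never below \<open>\<epsilon>\<close> is the Cauchy-Schwarz
  inequality. The constant \<open>C\<^sub>m\<close> is the maximum of those for the two parts.

  Fourier coefficients are limits of discrete Fourier coefficients on grids, for which inversion and
  decay are statements about finite sums.
\<close>

section \<open>Functions of class \<open>C\<^sup>n\<close>\<close>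

text \<open>Two features of the problem shape the constant. Feasible vectors are symmetric about
  index K and W_K is built accordingly, so the trial vector carries the weights of the symmetrised
  bump rather than of w; the averaging estimate is needed for two bump functions and yields two
  constants. Moreover, scaling the observable scales averaging errors linearly but the residual at
  \<epsilon> = 0 quadratically, so a constant chosen for the averaging estimate alone need not serve
  the residual. What is shown is that one constant serves both; the averaging estimate survives any
  enlargement.

  The rate is paid for in derivatives: each summation by parts brings one small divisor, at least a
  multiple of |n|^(-\<nu>), so m of them weaken the decay |n|^(-k) to |n|^(-(k - m \<nu>)), which is
  summable over the lattice exactly when k - m \<nu> > d.

  On grids, Fourier inversion is an exact identity for every grid size. What must be uniform in the
  grid size is the decay, since it supplies the summable majorant for the passage to the
  limit.\<close>

lemma has_derivative_frechet:
  "f differentiable at x \<Longrightarrow> (f has_derivative (\<lambda>v. frechet_derivative f (at x) v)) (at x)"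
  using frechet_derivative_works by metis

lemma frechet_derivative_eqI:
  "(f has_derivative f') (at x) \<Longrightarrow> frechet_derivative f (at x) v = f' v"
  using frechet_derivative_at by metis

lemma Cn_on_Suc_imp: "Cn_on (Suc n) S f \<Longrightarrow> Cn_on n S f"
proof (induction n arbitrary: f)
  case 0
  then show ?case
    by (auto intro!: continuous_at_imp_continuous_on differentiable_imp_continuous_within)
qed auto

lemma Cn_on_cong:
  assumes "open S" "\<And>x. x \<in> S \<Longrightarrow> f x = g x" "Cn_on n S f"
  shows "Cn_on n S g"
  using assms(2,3)
proof (induction n arbitrary: f g)
  case 0
  then show ?case by (simp cong: continuous_on_cong)
next
  case (Suc n)
  have g: "(g has_derivative frechet_derivative f (at x)) (at x)" if "x \<in> S" for x
    using Suc.prems that assms(1)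
    by (auto intro: has_derivative_transform_within_open[OF has_derivative_frechet])
  have "Cn_on n S (\<lambda>x. frechet_derivative g (at x) v)" for v
    by (rule Suc.IH[of "\<lambda>x. frechet_derivative f (at x) v"])
      (use Suc.prems g frechet_derivative_eqI in \<open>fastforce+\<close>)
  with g show ?case by (auto simp: differentiable_def)
qed

text \<open>The derivatives in \<open>Cn_on\<close> are full derivatives at a point, not relative to
  \<open>S\<close>, so the neighbourhood \<open>T\<close> may vary with the point. This lets a map
  into a manifold be examined in one chart at a time.\<close>

lemma Cn_on_local:
  assumes "\<And>x. x \<in> S \<Longrightarrow> \<exists>T. open T \<and> x \<in> T \<and> Cn_on n T f"
  shows "Cn_on n S f"
  using assms
proof (induction n arbitrary: f)
  case 0
  then show ?case
    by (force intro!: continuous_at_imp_continuous_on simp: continuous_on_eq_continuous_at)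
next
  case (Suc n)
  show ?case
    unfolding Cn_on.simps
  proof (intro conjI ballI allI)
    fix x assume "x \<in> S" then show "f differentiable at x" using Suc.prems by fastforce
  next
    fix v show "Cn_on n S (\<lambda>x. frechet_derivative f (at x) v)"
      by (rule Suc.IH) (use Suc.prems in fastforce)
  qed
qed

lemma Cn_on_SucI:
  assumes "open S" "\<And>x. x \<in> S \<Longrightarrow> (f has_derivative f' x) (at x)"
    and "\<And>v. Cn_on n S (\<lambda>x. f' x v)"
  shows "Cn_on (Suc n) S f"
  unfolding Cn_on.simps
proof (intro conjI ballI allI)
  fix x assume "x \<in> S" then show "f differentiable at x" using assms(2) by (auto simp: differentiable_def)
next
  fix v show "Cn_on n S (\<lambda>x. frechet_derivative f (at x) v)"
    by (rule Cn_on_cong[OF assms(1) _ assms(3)[of v]]) (metis assms(2) frechet_derivative_eqI)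
qed

lemma Cn_on_SucD:
  assumes "Cn_on (Suc n) S f"
  shows "x \<in> S \<Longrightarrow> (f has_derivative frechet_derivative f (at x)) (at x)"
    and "Cn_on n S (\<lambda>x. frechet_derivative f (at x) v)"
  using assms has_derivative_frechet[of f x] by auto

lemma Cn_on_bounded_linear:
  assumes "open S" "bounded_linear L" "Cn_on n S f"
  shows "Cn_on n S (\<lambda>x. L (f x))"
  using assms(3)
proof (induction n arbitrary: f)
  case 0
  then show ?case using assms(2) by (simp add: bounded_linear.continuous_on)
next
  case (Suc n)
  show ?case
    by (rule Cn_on_SucI[OF assms(1) bounded_linear.has_derivative[OF assms(2) Cn_on_SucD(1)[OF Suc.prems]]])
      (use Suc.IH Cn_on_SucD(2)[OF Suc.prems] in auto)
qed

lemma Cn_on_const: "Cn_on n S (\<lambda>x. c)"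
  by (induction n arbitrary: c) auto

lemma Cn_on_add:
  assumes "open S" "Cn_on n S f" "Cn_on n S g"
  shows "Cn_on n S (\<lambda>x. f x + g x)"
  using assms(2,3)
proof (induction n arbitrary: f g)
  case 0
  then show ?case by (simp add: continuous_on_add)
next
  case (Suc n)
  show ?case
    by (rule Cn_on_SucI[OF assms(1) has_derivative_add[OF Cn_on_SucD(1)[OF Suc.prems(1)] Cn_on_SucD(1)[OF Suc.prems(2)]]])
      (use Suc.IH Cn_on_SucD(2)[OF Suc.prems(1)] Cn_on_SucD(2)[OF Suc.prems(2)] in auto)
qed

lemma Cn_on_sum:
  assumes "open S" "\<And>i. i \<in> I \<Longrightarrow> Cn_on n S (f i)"
  shows "Cn_on n S (\<lambda>x. \<Sum>i\<in>I. f i x)"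
  using assms(2)
  by (induction I rule: infinite_finite_induct) (auto intro: Cn_on_const Cn_on_add[OF assms(1)])

lemma Cn_on_scaleR:
  assumes "open S" "Cn_on n S a" "Cn_on n S f"
  shows "Cn_on n S (\<lambda>x. a x *\<^sub>R f x)"
  using assms(2,3)
proof (induction n arbitrary: a f)
  case 0
  then show ?case by (simp add: continuous_on_scaleR)
next
  case (Suc n)
  show ?case
    by (rule Cn_on_SucI[OF assms(1) has_derivative_scaleR[OF Cn_on_SucD(1)[OF Suc.prems(1)] Cn_on_SucD(1)[OF Suc.prems(2)]]])
      (use Suc.IH Cn_on_SucD(2)[OF Suc.prems(1)] Cn_on_SucD(2)[OF Suc.prems(2)]
          Cn_on_Suc_imp[OF Suc.prems(1)] Cn_on_Suc_imp[OF Suc.prems(2)]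
       in \<open>auto intro!: Cn_on_add[OF assms(1)]\<close>)
qed

text \<open>The chain rule produces the derivative of \<open>f\<close> in a direction that moves
  with x, whereas \<open>Cn_on\<close> controls derivatives in fixed directions only. Expanding the
  direction in \<open>Basis\<close> gives a finite sum of products, each of class C^n by
  induction.\<close>

lemma Cn_on_compose:
  fixes g :: "'a::euclidean_space \<Rightarrow> 'b::euclidean_space"
  assumes "open S" "g ` S \<subseteq> T" "Cn_on n T f" "Cn_on n S g"
  shows "Cn_on n S (\<lambda>x. f (g x))"
  using assms(3,4)
proof (induction n arbitrary: f)
  case 0
  then show ?case using assms(2) by (auto intro: continuous_on_compose2)
next
  case (Suc n)
  have d: "((\<lambda>x. f (g x)) has_derivative
      (\<lambda>v. \<Sum>b\<in>Basis. (frechet_derivative g (at x) v \<bullet> b) *\<^sub>R frechet_derivative f (at (g x)) b)) (at x)"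
    if "x \<in> S" for x
  proof -
    have f: "(f has_derivative frechet_derivative f (at (g x))) (at (g x))"
      using Cn_on_SucD(1)[OF Suc.prems(1)] that assms(2) by blast
    have "frechet_derivative f (at (g x)) y =
        (\<Sum>b\<in>Basis. (y \<bullet> b) *\<^sub>R frechet_derivative f (at (g x)) b)" for y
      using has_derivative_linear[OF f]
      by (subst euclidean_representation[of y, symmetric]) (simp only: linear_sum linear_cmul)
    then have "(\<lambda>v. frechet_derivative f (at (g x)) (frechet_derivative g (at x) v)) =
        (\<lambda>v. \<Sum>b\<in>Basis. (frechet_derivative g (at x) v \<bullet> b) *\<^sub>R frechet_derivative f (at (g x)) b)"
      by (rule ext)
    with has_derivative_compose[OF Cn_on_SucD(1)[OF Suc.prems(2) that] f]
    show ?thesis by (rule has_derivative_eq_rhs)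
  qed
  show ?case
  proof (rule Cn_on_SucI[OF assms(1) d], assumption)
    fix v
    have "Cn_on n S (\<lambda>x. (frechet_derivative g (at x) v \<bullet> b) *\<^sub>R frechet_derivative f (at (g x)) b)" for b
      by (intro Cn_on_scaleR[OF assms(1)]
            Cn_on_bounded_linear[OF assms(1) bounded_linear_inner_left Cn_on_SucD(2)[OF Suc.prems(2)]]
            Suc.IH[of "\<lambda>y. frechet_derivative f (at y) b"] Cn_on_SucD(2)[OF Suc.prems(1)]
            Cn_on_Suc_imp[OF Suc.prems(2)])
    then show "Cn_on n S (\<lambda>x. \<Sum>b\<in>Basis. (frechet_derivative g (at x) v \<bullet> b) *\<^sub>R frechet_derivative f (at (g x)) b)"
      by (intro Cn_on_sum[OF assms(1)])
  qed
qed

text \<open>Regularity of \<open>h\<close> and \<open>z\<close> is known only through charts. Near a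
  point, \<open>h (z y)\<close> factors through one chart of \<open>X\<close> into two maps between
  Euclidean spaces. Once this is known, only the topology and the measure of \<open>X\<close> still
  matter.\<close>

lemma Cn_on_observable_compose:
  fixes X :: "'x topology" and A :: "('x, 'e::euclidean_space) chart set"
    and z :: "'a::euclidean_space \<Rightarrow> 'x" and h :: "'x \<Rightarrow> 'v::euclidean_space"
  assumes X: "Ck_manifold M X A" and h: "Ck_map M X A euclidean std_atlas h"
    and z: "Ck_map M euclidean std_atlas X A z" and k: "enat k \<le> M"
  shows "Cn_on k UNIV (\<lambda>x. h (z x))"
proof (rule Cn_on_local)
  fix x
  have zc: "continuous_map euclidean X z" using z by (auto simp: Ck_map_def)
  then have "z x \<in> topspace X" by (auto simp: continuous_map_def)
  moreover have "(\<Union>(U, \<phi>)\<in>A. U) = topspace X" using X unfolding Ck_manifold_def by blast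
  ultimately have "z x \<in> (\<Union>(U, \<phi>)\<in>A. U)" by simp
  then obtain V \<psi> where V: "(V, \<psi>) \<in> A" "z x \<in> V" by auto
  then have ch: "is_chart X (V, \<psi>)" using X by (auto simp: Ck_manifold_def)
  have oV: "openin X V" using ch by (simp add: is_chart_def)
  have inj: "inj_on \<psi> V"
  proof -
    have "homeomorphic_map (subtopology X V) (top_of_set (\<psi> ` V)) \<psi>" using ch by (simp add: is_chart_def)
    from homeomorphic_imp_injective_map[OF this] show ?thesis
      using openin_subset[OF oV] by (simp add: Int_absorb1)
  qed
  have op: "open (z -` V)" using openin_continuous_map_preimage[OF zc oV] by (simp add: vimage_def)
  have 1: "Cn_on k (z -` V) (\<lambda>y. \<psi> (z y))"
    using z k V by (auto simp: Ck_map_def std_atlas_def Ck_on_def o_def)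
  have 2: "Cn_on k (\<psi> ` V) (\<lambda>y. h (inv_into V \<psi> y))"
    using h k V by (auto simp: Ck_map_def std_atlas_def Ck_on_def o_def)
  have "Cn_on k (z -` V) (\<lambda>y. h (inv_into V \<psi> (\<psi> (z y))))"
    by (rule Cn_on_compose[OF op _ 2 1]) auto
  then have "Cn_on k (z -` V) (\<lambda>y. h (z y))"
    by (rule Cn_on_cong[OF op, rotated]) (simp add: inv_into_f_f[OF inj])
  with op V show "\<exists>T. open T \<and> x \<in> T \<and> Cn_on k T (\<lambda>x. h (z x))" by blast
qed

section \<open>Finite differences\<close>

primrec fdiff :: "'a::real_vector \<Rightarrow> nat \<Rightarrow> ('a \<Rightarrow> 'b::real_vector) \<Rightarrow> 'a \<Rightarrow> 'b" where
  "fdiff u 0 f = f"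
| "fdiff u (Suc k) f = (\<lambda>x. fdiff u k f (x + u) - fdiff u k f x)"

lemma fdiff_has_derivative:
  fixes f :: "'a::real_normed_vector \<Rightarrow> 'b::real_normed_vector"
  assumes "\<And>x. (f has_derivative f' x) (at x)"
  shows "(fdiff u k f has_derivative (\<lambda>v. fdiff u k (\<lambda>x. f' x v) x)) (at x)"
proof (induction k arbitrary: x)
  case 0
  then show ?case using assms by simp
next
  case (Suc k)
  have "((\<lambda>x. fdiff u k f (x + u)) has_derivative (\<lambda>v. fdiff u k (\<lambda>x. f' x v) (x + u))) (at x)"
    by (rule has_derivative_compose[of "\<lambda>x. x + u" "\<lambda>v. v" x UNIV, OF _ Suc[of "x + u"]])
      (auto intro!: derivative_eq_intros)
  then show ?case using Suc by (auto intro!: has_derivative_diff)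
qed

text \<open>The k-th difference with step s v behaves like s^k times a k-th derivative along v: one
  more difference is an increment along s v, which the mean value inequality bounds, and the
  derivative of a difference is the difference of the derivative. \<open>P\<close> is a class that
  forces boundedness and is stable under differentiation along \<open>v\<close>: periodicity for
  torus functions, vanishing outside [0,1] for the bump function.\<close>

lemma fdiff_bound:
  fixes f :: "'a::euclidean_space \<Rightarrow> 'b::real_normed_vector"
  assumes bdd: "\<And>f. P f \<Longrightarrow> continuous_on UNIV f \<Longrightarrow> bounded (range f)"
    and der: "\<And>f. P f \<Longrightarrow> (\<And>x. f differentiable (at x)) \<Longrightarrow> P (\<lambda>x. frechet_derivative f (at x) v)"
    and "P f" "Cn_on k UNIV f"
  shows "\<exists>B\<ge>0. \<forall>s x. norm (fdiff (s *\<^sub>R v) k f x) \<le> B * \<bar>s\<bar> ^ k"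
  using assms(3,4)
proof (induction k arbitrary: f)
  case 0
  then have "bounded (range f)" by (intro bdd) auto
  then obtain B where "\<forall>x. norm (f x) \<le> B" by (auto simp: bounded_iff)
  moreover from this have "B \<ge> 0" using norm_ge_zero order_trans by blast
  ultimately show ?case by auto
next
  case (Suc k)
  let ?g = "\<lambda>x. frechet_derivative f (at x) v"
  obtain B where B: "B \<ge> 0" "\<And>s x. norm (fdiff (s *\<^sub>R v) k ?g x) \<le> B * \<bar>s\<bar> ^ k"
    using Suc.IH[of ?g] der[OF Suc.prems(1)] Suc.prems(2) by fastforce
  have "norm (fdiff (s *\<^sub>R v) (Suc k) f x) \<le> B * \<bar>s\<bar> ^ Suc k" for s x
  proof -
    let ?u = "s *\<^sub>R v"
    let ?\<phi> = "\<lambda>t. fdiff ?u k f (x + t *\<^sub>R ?u)"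
    have d: "(?\<phi> has_derivative (\<lambda>\<tau>. \<tau> *\<^sub>R (s *\<^sub>R fdiff ?u k ?g (x + t *\<^sub>R ?u)))) (at t within {0..1})" for t
    proof -
      have F: "(fdiff ?u k f has_derivative (\<lambda>v. fdiff ?u k (\<lambda>x. frechet_derivative f (at x) v) y)) (at y)" for y
        by (rule fdiff_has_derivative) (use Suc.prems(2) Cn_on_SucD(1) in blast)
      note lin = linear_cmul[OF has_derivative_linear[OF F]]
      have "((\<lambda>t. x + t *\<^sub>R ?u) has_derivative (\<lambda>\<tau>. \<tau> *\<^sub>R ?u)) (at t within {0..1})"
        by (auto intro!: derivative_eq_intros)
      from has_derivative_compose[OF this F] show ?thesis by (simp only: lin)
    qed
    have "norm (?\<phi> 1 - ?\<phi> 0) \<le> (\<bar>s\<bar> * (B * \<bar>s\<bar> ^ k)) * norm (1 - 0 :: real)"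
    proof (rule differentiable_bound[OF convex_real_interval(5)[of 0 1] d])
      fix t :: real
      show "onorm (\<lambda>\<tau>. \<tau> *\<^sub>R (s *\<^sub>R fdiff ?u k ?g (x + t *\<^sub>R ?u))) \<le> \<bar>s\<bar> * (B * \<bar>s\<bar> ^ k)"
      proof (rule onorm_le)
        fix \<tau> :: real
        have "\<bar>\<tau>\<bar> * (\<bar>s\<bar> * norm (fdiff ?u k ?g (x + t *\<^sub>R ?u))) \<le> \<bar>\<tau>\<bar> * (\<bar>s\<bar> * (B * \<bar>s\<bar> ^ k))"
          by (intro mult_left_mono B(2)) auto
        then show "norm (\<tau> *\<^sub>R (s *\<^sub>R fdiff ?u k ?g (x + t *\<^sub>R ?u))) \<le> \<bar>s\<bar> * (B * \<bar>s\<bar> ^ k) * norm \<tau>"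
          by (simp only: norm_scaleR real_norm_def mult_ac)
      qed
    qed auto
    then show ?thesis by (simp add: mult_ac)
  qed
  with B(1) show ?case by blast
qed

section \<open>Periodic functions on \<open>\<real>\<^sup>d\<close>\<close>

definition torus_periodic :: "(real ^ 'd \<Rightarrow> 'v) \<Rightarrow> bool" where
  "torus_periodic f \<longleftrightarrow> (\<forall>x n. f (x + int_vec n) = f x)"

lemma torus_periodicD: "torus_periodic f \<Longrightarrow> f (x + int_vec n) = f x"
  by (simp add: torus_periodic_def)

lemma int_vec_nth [simp]: "int_vec n $ i = of_int (n $ i)"
  by (simp add: int_vec_def)

lemma int_vec_zero [simp]: "int_vec 0 = 0"
  by (simp add: vec_eq_iff)

lemma int_vec_eq_0_iff [simp]: "int_vec n = 0 \<longleftrightarrow> n = 0"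
  by (simp add: vec_eq_iff)

lemma inner_int_vec: "int_vec m \<bullet> int_vec n = of_int (\<Sum>i\<in>UNIV. m $ i * n $ i)"
  by (simp add: inner_vec_def)

lemma cis_2pi_int [simp]: "cis (2 * pi * of_int n) = 1"
  by (rule cis_multiple_2pi) auto

lemma torus_periodic_cis: "torus_periodic (\<lambda>x. cis (2 * pi * (int_vec n \<bullet> x)))"
  unfolding torus_periodic_def
  by (simp add: inner_right_distrib distrib_left cis_mult[symmetric] inner_int_vec del: of_int_sum)

lemma torus_reduce: obtains n where "x + int_vec n \<in> cbox 0 (1 :: real ^ 'd)"
proof
  show "x + int_vec (\<chi> i. - \<lfloor>x $ i\<rfloor>) \<in> cbox 0 1"
    by (simp add: mem_box_cart) linarith
qed

lemma torus_periodic_bounded: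
  fixes f :: "real ^ 'd \<Rightarrow> 'v::real_normed_vector"
  assumes "torus_periodic f" "continuous_on UNIV f"
  shows "bounded (range f)"
proof -
  have "range f \<subseteq> f ` cbox 0 1"
  proof clarsimp
    fix x
    obtain n where "x + int_vec n \<in> cbox 0 (1 :: real ^ 'd)" by (rule torus_reduce)
    then show "f x \<in> f ` cbox 0 1" using torus_periodicD[OF assms(1), of x n] by (metis image_eqI)
  qed
  moreover have "compact (f ` cbox 0 1)"
    by (intro compact_continuous_image continuous_on_subset[OF assms(2)]) auto
  ultimately show ?thesis by (meson bounded_subset compact_imp_bounded)
qed

lemma torus_periodic_uniformly_continuous:
  fixes f :: "real ^ 'd \<Rightarrow> 'v::real_normed_vector"
  assumes "torus_periodic f" "continuous_on UNIV f"
  shows "uniformly_continuous_on UNIV f"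
  unfolding uniformly_continuous_on_def
proof (intro allI impI)
  fix e :: real assume "e > 0"
  \<comment> \<open>The unit cube enlarged by 1 on every side: once x is shifted into the cube, a
    point within distance 1 of x stays in \<open>?K\<close> under the same shift.\<close>
  let ?K = "cbox (-1) 2 :: (real ^ 'd) set"
  have "uniformly_continuous_on ?K f"
    by (intro compact_uniformly_continuous continuous_on_subset[OF assms(2)]) auto
  then obtain d where d: "d > 0" "\<And>x y. x \<in> ?K \<Longrightarrow> y \<in> ?K \<Longrightarrow> dist y x < d \<Longrightarrow> dist (f y) (f x) < e"
    using \<open>e > 0\<close> unfolding uniformly_continuous_on_def by metis
  have "dist (f y) (f x) < e" if "dist y x < min d 1" for x y
  proof -
    obtain n where n: "x + int_vec n \<in> cbox 0 (1 :: real ^ 'd)" by (rule torus_reduce)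
    have c: "\<bar>y $ i - x $ i\<bar> \<le> 1" for i
      using component_le_norm_cart[of "y - x" i] that by (simp add: dist_norm)
    have "x + int_vec n \<in> ?K" "y + int_vec n \<in> ?K"
    proof -
      show "x + int_vec n \<in> ?K" using n by (simp add: mem_box_cart) (smt (verit))
      have "- 1 \<le> y $ i + of_int (n $ i) \<and> y $ i + of_int (n $ i) \<le> 2" for i
        using n c[of i] by (simp add: mem_box_cart) (smt (verit))
      then show "y + int_vec n \<in> ?K" by (simp add: mem_box_cart)
    qed
    then have "dist (f (y + int_vec n)) (f (x + int_vec n)) < e" using that by (intro d) auto
    then show ?thesis by (simp add: torus_periodicD[OF assms(1)])
  qed
  then show "\<exists>d>0. \<forall>x\<in>UNIV. \<forall>x'\<in>UNIV. dist x' x < d \<longrightarrow> dist (f x') (f x) < e"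
    using d(1) by (intro exI[of _ "min d 1"]) auto
qed

lemma torus_periodic_frechet:
  assumes "torus_periodic f" "\<And>x. f differentiable (at x)"
  shows "torus_periodic (\<lambda>x. frechet_derivative f (at x) v)"
  unfolding torus_periodic_def
proof (intro allI)
  fix x n
  have "((\<lambda>y. f (y + int_vec n)) has_derivative frechet_derivative f (at (x + int_vec n))) (at x)"
    by (rule has_derivative_compose[of "\<lambda>y. y + int_vec n" "\<lambda>v. v" x UNIV, OF _ has_derivative_frechet[OF assms(2)]])
      (auto intro!: derivative_eq_intros)
  then have "(f has_derivative frechet_derivative f (at (x + int_vec n))) (at x)"
    by (simp add: torus_periodicD[OF assms(1)])
  from frechet_derivative_eqI[OF this]
  show "frechet_derivative f (at (x + int_vec n)) v = frechet_derivative f (at x) v" by simp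
qed

lemma torus_periodic_fdiff: "torus_periodic f \<Longrightarrow> torus_periodic (fdiff u k f)"
proof (induction k)
  case (Suc k)
  then show ?case
    unfolding torus_periodic_def by (auto simp: add.assoc add.commute[of u] simp flip: add.assoc)
       (metis add.assoc add.commute)
qed auto

section \<open>Lattice sums\<close>

definition lattice_box :: "int set \<Rightarrow> (int ^ 'd) set" where
  "lattice_box S = {v. \<forall>i. v $ i \<in> S}"

lemma bij_betw_vec_lambda_lattice_box:
  "bij_betw vec_lambda (PiE UNIV (\<lambda>_. S)) (lattice_box S :: (int ^ 'd) set)"
  by (rule bij_betw_byWitness[where f' = vec_nth]) (auto simp: lattice_box_def)

lemma finite_lattice_box [simp]: "finite S \<Longrightarrow> finite (lattice_box S :: (int ^ 'd) set)"
  using bij_betw_finite[OF bij_betw_vec_lambda_lattice_box] finite_PiE by (metis finite)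

text \<open>Reduces d-dimensional lattice sums to one-dimensional ones, both for the summability of
  powers of the norm and for the Fourier kernel on a grid.\<close>

lemma sum_prod_lattice_box:
  fixes g :: "'d::finite \<Rightarrow> int \<Rightarrow> 'a::comm_semiring_1"
  assumes "finite S"
  shows "(\<Sum>v\<in>(lattice_box S :: (int ^ 'd) set). \<Prod>i\<in>UNIV. g i (v $ i)) = (\<Prod>i\<in>UNIV. \<Sum>y\<in>S. g i y)"
  by (subst prod_sum_PiE) (use assms sum.reindex_bij_betw[OF bij_betw_vec_lambda_lattice_box, of "\<lambda>v. \<Prod>i\<in>UNIV. g i (v $ i)"] in auto)

lemma card_lattice_box:
  "finite S \<Longrightarrow> card (lattice_box S :: (int ^ 'd) set) = card S ^ CARD('d)"
  using sum_prod_lattice_box[of S "\<lambda>(_ :: 'd) _. 1 :: nat"] by simp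

lemma sum_int_powr_le:
  fixes \<sigma> :: real
  assumes "\<sigma> > 1"
  shows "\<exists>B. \<forall>r. (\<Sum>y\<in>{-int r..int r}. (1 + \<bar>real_of_int y\<bar>) powr - \<sigma>) \<le> B"
proof -
  let ?g = "\<lambda>k. real (Suc k) powr - \<sigma>"
  have "summable (\<lambda>k. real k powr - \<sigma>)" using assms by (simp add: summable_real_powr_iff)
  then have s: "summable ?g" by (subst summable_Suc_iff)
  have "(\<Sum>y\<in>{-int r..int r}. (1 + \<bar>real_of_int y\<bar>) powr - \<sigma>) \<le> 2 * suminf ?g" for r
  proof -
    let ?f = "\<lambda>y. (1 + \<bar>real_of_int y\<bar>) powr - \<sigma>"
    have U: "{-int r..int r} = int ` {..r} \<union> (\<lambda>k. - int k) ` {..r}"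
    proof safe
      fix x assume x: "x \<in> {- int r..int r}" "x \<notin> (\<lambda>k. - int k) ` {..r}"
      have "x \<ge> 0"
      proof (rule ccontr)
        assume "\<not> x \<ge> 0"
        then have "x = - int (nat (- x))" "nat (- x) \<le> r" using x(1) by auto
        with x(2) show False by (metis atMost_iff imageI)
      qed
      then show "x \<in> int ` {..r}" using x(1) by (intro image_eqI[of _ _ "nat x"]) auto
    qed auto
    have "sum ?f {-int r..int r} \<le> sum ?f (int ` {..r}) + sum ?f ((\<lambda>k. - int k) ` {..r})"
      unfolding U by (subst sum.union_inter[symmetric]) (auto intro!: sum_nonneg)
    also have "\<dots> = 2 * sum ?g {..r}"
      by (subst (1 2) sum.reindex) (auto simp: inj_on_def add.commute)
    also have "\<dots> \<le> 2 * suminf ?g"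
      by (intro mult_left_mono sum_le_suminf s) auto
    finally show ?thesis .
  qed
  then show ?thesis by blast
qed

text \<open>For n \<noteq> 0 every coordinate satisfies 1 + |n_i| \<le> 2 |n|, so |n|^(-t) is at
  most 2^t times the product over i of (1 + |n_i|)^(-t/d). The exponent t/d exceeds 1, and the
  product of one-dimensional series converges. The term at n = 0 is 0 because
  \<open>0 powr s = 0\<close>.\<close>

lemma summable_on_lattice_powr:
  fixes t :: real
  assumes t: "real CARD('d) < t"
  shows "(\<lambda>n :: int ^ 'd. norm (int_vec n) powr - t) summable_on UNIV"
proof (rule nonneg_bdd_above_summable_on)
  define \<sigma> where "\<sigma> = t / real CARD('d)"
  have \<sigma>: "\<sigma> > 1" using t by (simp add: \<sigma>_def)
  obtain B where B: "\<And>r. (\<Sum>y\<in>{-int r..int r}. (1 + \<bar>real_of_int y\<bar>) powr - \<sigma>) \<le> B"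
    using sum_int_powr_le[OF \<sigma>] by blast
  have le: "norm (int_vec n) powr - t \<le> 2 powr t * (\<Prod>i\<in>UNIV. (1 + \<bar>real_of_int (n $ i)\<bar>) powr - \<sigma>)"
    for n :: "int ^ 'd"
  proof (cases "n = 0")
    case False
    then obtain i0 where i0: "n $ i0 \<noteq> 0" by (auto simp: vec_eq_iff)
    let ?N = "norm (int_vec n)"
    have c: "\<bar>real_of_int (n $ i)\<bar> \<le> ?N" for i using component_le_norm_cart[of "int_vec n" i] by simp
    have "1 \<le> \<bar>real_of_int (n $ i0)\<bar>" using i0 by linarith
    with c[of i0] have N1: "?N \<ge> 1" by linarith
    have "(2 * ?N) powr - t = (\<Prod>i\<in>(UNIV :: 'd set). (2 * ?N) powr - \<sigma>)"
    proof -
      have "(2 * ?N) powr - t = ((2 * ?N) powr - \<sigma>) powr real CARD('d)"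
        by (simp add: powr_powr \<sigma>_def)
      also have "\<dots> = ((2 * ?N) powr - \<sigma>) ^ CARD('d)"
        using False by (intro powr_realpow) simp
      finally show ?thesis by simp
    qed
    also have "\<dots> \<le> (\<Prod>i\<in>UNIV. (1 + \<bar>real_of_int (n $ i)\<bar>) powr - \<sigma>)"
    proof (rule prod_mono, safe)
      fix i
      have "1 + \<bar>real_of_int (n $ i)\<bar> \<le> 2 * ?N" using c[of i] N1 by linarith
      then show "(2 * ?N) powr - \<sigma> \<le> (1 + \<bar>real_of_int (n $ i)\<bar>) powr - \<sigma>"
        using \<sigma> by (intro powr_mono2') auto
    qed auto
    finally have "2 powr t * (2 * ?N) powr - t \<le> 2 powr t * (\<Prod>i\<in>UNIV. (1 + \<bar>real_of_int (n $ i)\<bar>) powr - \<sigma>)"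
      by (rule mult_left_mono) simp
    moreover have "2 powr t * (2 * ?N) powr - t = ?N powr - t"
      by (simp add: powr_mult powr_minus)
    ultimately show ?thesis by simp
  qed (simp add: prod_nonneg)
  show "bdd_above (sum (\<lambda>n :: int ^ 'd. norm (int_vec n) powr - t) ` {F. F \<subseteq> UNIV \<and> finite F})"
  proof (rule bdd_aboveI2)
    fix F :: "(int ^ 'd) set" assume "F \<in> {F. F \<subseteq> UNIV \<and> finite F}"
    then have F: "finite F" by simp
    obtain r where r: "F \<subseteq> lattice_box {-int r..int r}"
    proof
      let ?r = "nat (\<Sum>n\<in>F. \<Sum>i\<in>UNIV. \<bar>n $ i\<bar>)"
      show "F \<subseteq> lattice_box {-int ?r..int ?r}"
      proof
        fix n assume n: "n \<in> F"
        have "\<bar>n $ i\<bar> \<le> int ?r" for i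
        proof -
          have "\<bar>n $ i\<bar> \<le> (\<Sum>i\<in>UNIV. \<bar>n $ i\<bar>)" by (rule member_le_sum) auto
          also have "\<dots> \<le> (\<Sum>n\<in>F. \<Sum>i\<in>UNIV. \<bar>n $ i\<bar>)"
            using n F by (intro member_le_sum[where f = "\<lambda>n. \<Sum>i\<in>UNIV. \<bar>n $ i\<bar>"]) (auto intro: sum_nonneg)
          finally show ?thesis by linarith
        qed
        then have "- int ?r \<le> n $ i \<and> n $ i \<le> int ?r" for i by (smt (verit))
        then show "n \<in> lattice_box {-int ?r..int ?r}" unfolding lattice_box_def by simp
      qed
    qed
    have "(\<Sum>n\<in>F. norm (int_vec n) powr - t)
        \<le> (\<Sum>n\<in>F. 2 powr t * (\<Prod>i\<in>UNIV. (1 + \<bar>real_of_int (n $ i)\<bar>) powr - \<sigma>))"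
      by (intro sum_mono le)
    also have "\<dots> \<le> (\<Sum>n\<in>lattice_box {-int r..int r}. 2 powr t * (\<Prod>i\<in>(UNIV :: 'd set). (1 + \<bar>real_of_int (n $ i)\<bar>) powr - \<sigma>))"
      by (rule sum_mono2) (auto intro!: mult_nonneg_nonneg prod_nonneg r)
    also have "\<dots> = 2 powr t * (\<Prod>i\<in>(UNIV :: 'd set). \<Sum>y\<in>{-int r..int r}. (1 + \<bar>real_of_int y\<bar>) powr - \<sigma>)"
      by (simp add: sum_distrib_left[symmetric] sum_prod_lattice_box[where g = "\<lambda>i y. (1 + \<bar>real_of_int y\<bar>) powr - \<sigma>"] del: prod_constant)
    also have "\<dots> \<le> 2 powr t * (\<Prod>i\<in>(UNIV :: 'd set). B)"
      by (intro mult_left_mono prod_mono conjI B sum_nonneg) auto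
    finally show "(\<Sum>n\<in>F. norm (int_vec n) powr - t) \<le> 2 powr t * (\<Prod>i\<in>(UNIV :: 'd set). B)" .
  qed
qed auto

section \<open>Grid averages\<close>

text \<open>Dominated convergence for series whose finite index sets grow with r. Once a finite set
  exhausts the majorant \<open>D\<close> up to e/2, any finite sum over a larger set misses the
  exact value \<open>c\<close> by at most e/2 for all large r; only then is r sent to
  infinity.\<close>

lemma has_sum_tannery:
  fixes g :: "nat \<Rightarrow> 'a \<Rightarrow> 'b::real_normed_vector" and D :: "'a \<Rightarrow> real"
  assumes D: "D summable_on UNIV"
    and fin: "\<And>r. finite (A r)" and ex: "\<And>n. eventually (\<lambda>r. n \<in> A r) sequentially"
    and bd: "\<And>r n. n \<in> A r \<Longrightarrow> norm (g r n) \<le> D n"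
    and lim: "\<And>n. (\<lambda>r. g r n) \<longlonglongrightarrow> b n"
    and sum: "\<And>r. (\<Sum>n\<in>A r. g r n) = c"
  shows "(b has_sum c) UNIV"
  unfolding has_sum_def tendsto_iff eventually_finite_subsets_at_top
proof (intro allI impI)
  fix e :: real assume e: "e > 0"
  have D0: "D n \<ge> 0" for n
    using eventually_happens'[OF _ ex[of n]] bd norm_ge_zero order_trans by (metis sequentially_bot)
  obtain F where F: "finite F" "dist (sum D F) (infsum D UNIV) \<le> e / 2"
    using has_sum_finite_approximation[OF has_sum_infsum[OF D], of "e/2"] e by auto
  have "dist (sum b Y) c < e" if Y: "finite Y" "F \<subseteq> Y" for Y
  proof -
    have "eventually (\<lambda>r. Y \<subseteq> A r) sequentially"
      unfolding subset_eq by (rule eventually_ball_finite) (use Y ex in auto)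
    then have "eventually (\<lambda>r. dist (\<Sum>n\<in>Y. g r n) c \<le> e / 2) sequentially"
    proof eventually_elim
      case (elim r)
      have fD: "finite (A r - Y)" using fin by auto
      have "c = (\<Sum>n\<in>Y. g r n) + (\<Sum>n\<in>A r - Y. g r n)"
        using sum.subset_diff[OF elim fin, of "g r"] sum[of r] by simp
      then have "dist (\<Sum>n\<in>Y. g r n) c = norm (\<Sum>n\<in>A r - Y. g r n)" by (simp add: dist_norm)
      also have "\<dots> \<le> (\<Sum>n\<in>A r - Y. D n)" using bd by (intro sum_norm_le) auto
      \<comment> \<open>Restoring the terms of \<open>F\<close> exhibits the remainder as part of
        the tail of \<open>D\<close> outside \<open>F\<close>.\<close>
      also have "\<dots> = sum D ((A r - Y) \<union> F) - sum D F"
        using Y fD F(1) by (subst sum.union_disjoint) auto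
      also have "sum D ((A r - Y) \<union> F) \<le> infsum D UNIV"
        using fD F(1) D0 by (intro finite_sum_le_infsum[OF D]) auto
      finally show ?case using F(2) unfolding dist_real_def by linarith
    qed
    moreover have "(\<lambda>r. dist (\<Sum>n\<in>Y. g r n) c) \<longlonglongrightarrow> dist (sum b Y) c"
      by (intro tendsto_intros lim)
    ultimately have "dist (sum b Y) c \<le> e / 2"
      by (intro tendsto_upperbound[where F = sequentially]) auto
    then show ?thesis using e by simp
  qed
  with F(1) show "\<exists>X. finite X \<and> X \<subseteq> UNIV \<and> (\<forall>Y. finite Y \<and> X \<subseteq> Y \<and> Y \<subseteq> UNIV \<longrightarrow> dist (sum b Y) c < e)"
    by auto
qed

text \<open>A Riemann sum over the unit cube with q^d nodes, in place of integration over the torus: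
  translations by multiples of 1/q are exact symmetries of it on periodic functions.\<close>

definition gmean :: "nat \<Rightarrow> (real ^ 'd \<Rightarrow> complex) \<Rightarrow> complex" where
  "gmean q \<phi> = (\<Sum>j\<in>lattice_box {0..<int q}. \<phi> (int_vec j /\<^sub>R real q)) / of_nat (q ^ CARD('d))"

lemma gmean_cmult: "gmean q (\<lambda>x. c * \<phi> x) = c * gmean q \<phi>"
  by (simp add: gmean_def sum_distrib_left)

lemma gmean_diff: "gmean q (\<lambda>x. \<phi> x - \<psi> x) = gmean q \<phi> - gmean q \<psi>"
  by (simp add: gmean_def sum_subtractf diff_divide_distrib)

lemma gmean_const: "q > 0 \<Longrightarrow> gmean q (\<lambda>x :: real ^ 'd. c) = c"
  by (simp add: gmean_def card_lattice_box)

lemma gmean_swap: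
  "gmean q (\<lambda>x. gmean q' (\<lambda>y. \<phi> x y)) = gmean q' (\<lambda>y. gmean q (\<lambda>x. \<phi> x y))"
  unfolding gmean_def sum_divide_distrib
  by (subst sum.swap) (simp add: mult.commute)

lemma norm_gmean_le:
  fixes \<phi> :: "real ^ 'd \<Rightarrow> complex"
  assumes "\<And>x. norm (\<phi> x) \<le> B"
  shows "norm (gmean q \<phi>) \<le> B"
proof (cases "q = 0")
  case True
  have "B \<ge> 0" using assms norm_ge_zero order_trans by blast
  then show ?thesis using True by (simp add: gmean_def zero_power)
next
  case False
  have "norm (\<Sum>j\<in>lattice_box {0..<int q}. \<phi> (int_vec j /\<^sub>R real q))
      \<le> of_nat (card (lattice_box {0..<int q} :: (int ^ 'd) set)) * B"
    by (intro sum_norm_bound assms)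
  then show ?thesis using False by (simp add: gmean_def norm_divide norm_power card_lattice_box field_simps)
qed

text \<open>Translation by s/q permutes the grid modulo integer vectors: the remainder modulo q is
  the new node, the quotient an integer shift absorbed by periodicity.\<close>

lemma gmean_shift:
  fixes \<phi> :: "real ^ 'd \<Rightarrow> complex"
  assumes "q > 0" "torus_periodic \<phi>"
  shows "gmean q (\<lambda>x. \<phi> (x + int_vec s /\<^sub>R real q)) = gmean q \<phi>"
proof -
  let ?m = "\<lambda>s j :: int ^ 'd. (\<chi> i. (j $ i + s $ i) mod int q) :: int ^ 'd"
  let ?G = "lattice_box {0..<int q} :: (int ^ 'd) set"
  have bij: "bij_betw (?m s) ?G ?G"
    by (rule bij_betw_byWitness[where f' = "?m (- s)"])
      (use assms(1) in \<open>auto simp: lattice_box_def vec_eq_iff mod_diff_left_eq mod_add_left_eq\<close>)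
  have "\<phi> (int_vec j /\<^sub>R real q + int_vec s /\<^sub>R real q) = \<phi> (int_vec (?m s j) /\<^sub>R real q)" for j
  proof -
    have e: "real_of_int (a div int q) + real_of_int (a mod int q) / real q = real_of_int a / real q" for a
    proof -
      have "real_of_int (int q * (a div int q) + a mod int q) = real_of_int a"
        by (simp only: mult_div_mod_eq)
      then have "real_of_int a = real q * real_of_int (a div int q) + real_of_int (a mod int q)"
        unfolding of_int_add of_int_mult of_int_of_nat_eq by simp
      then show ?thesis using assms(1) by (simp add: add_divide_distrib)
    qed
    have "int_vec j /\<^sub>R real q + int_vec s /\<^sub>R real q
        = int_vec (?m s j) /\<^sub>R real q + int_vec (\<chi> i. (j $ i + s $ i) div int q)"
      using e[of "j $ i + s $ i" for i] by (simp add: vec_eq_iff field_simps) (simp add: add_divide_distrib)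
    then show ?thesis by (simp add: torus_periodicD[OF assms(2)])
  qed
  then show ?thesis
    unfolding gmean_def using sum.reindex_bij_betw[OF bij, of "\<lambda>j. \<phi> (int_vec j /\<^sub>R real q)"] by simp
qed

text \<open>Rounding \<tau> down to the grid changes it by at most \<open>CARD('d) / q\<close>, and
  grid translations are free, so only the modulus of continuity enters. The bound is uniform in
  \<tau>, so it can itself be averaged over a second grid.\<close>

lemma gmean_translate:
  fixes \<phi> :: "real ^ 'd \<Rightarrow> complex"
  assumes per: "torus_periodic \<phi>" and cont: "continuous_on UNIV \<phi>" and "e > 0"
  shows "\<exists>Q. \<forall>q\<ge>Q. \<forall>\<tau>. norm (gmean q (\<lambda>x. \<phi> (x + \<tau>)) - gmean q \<phi>) \<le> e"
proof -
  obtain d where d: "d > 0" "\<And>x y. dist x y < d \<Longrightarrow> dist (\<phi> x) (\<phi> y) < e"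
    using torus_periodic_uniformly_continuous[OF per cont] \<open>e > 0\<close>
    unfolding uniformly_continuous_on_def by (metis UNIV_I)
  obtain Q :: nat where Q: "real CARD('d) / d < real Q" using reals_Archimedean2 by blast
  have "norm (gmean q (\<lambda>x. \<phi> (x + \<tau>)) - gmean q \<phi>) \<le> e" if q: "q \<ge> Q" for q \<tau>
  proof -
    have "0 < real CARD('d) / d" using d(1) by simp
    with Q q have q0: "q > 0" and qd: "real CARD('d) / d < real q" by linarith+
    define s where "s = (\<chi> i. \<lfloor>real q * \<tau> $ i\<rfloor>)"
    have "norm (\<tau> - int_vec s /\<^sub>R real q) \<le> (\<Sum>i\<in>UNIV. \<bar>(\<tau> - int_vec s /\<^sub>R real q) $ i\<bar>)"
      by (rule norm_le_l1_cart)
    also have "\<dots> \<le> (\<Sum>i\<in>(UNIV :: 'd set). 1 / real q)"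
    proof (rule sum_mono)
      fix i
      have "(\<tau> - int_vec s /\<^sub>R real q) $ i = (real q * \<tau> $ i - of_int \<lfloor>real q * \<tau> $ i\<rfloor>) / real q"
        using q0 by (simp add: s_def field_simps)
      also have "\<bar>\<dots>\<bar> = \<bar>real q * \<tau> $ i - of_int \<lfloor>real q * \<tau> $ i\<rfloor>\<bar> / real q" by simp
      also have "\<dots> \<le> 1 / real q"
        by (rule divide_right_mono) linarith+
      finally show "\<bar>(\<tau> - int_vec s /\<^sub>R real q) $ i\<bar> \<le> 1 / real q" .
    qed
    also have "\<dots> < d" using qd q0 d(1) by (simp add: field_simps)
    finally have close: "norm (\<tau> - int_vec s /\<^sub>R real q) < d" .
    have "gmean q (\<lambda>x. \<phi> (x + \<tau>)) - gmean q \<phi>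
        = gmean q (\<lambda>x. \<phi> (x + \<tau>) - \<phi> (x + int_vec s /\<^sub>R real q))"
      by (simp add: gmean_diff gmean_shift[OF q0 per])
    also have "norm \<dots> \<le> e"
    proof (rule norm_gmean_le)
      fix x
      show "norm (\<phi> (x + \<tau>) - \<phi> (x + int_vec s /\<^sub>R real q)) \<le> e"
        using d(2)[of "x + \<tau>" "x + int_vec s /\<^sub>R real q"] close by (simp add: dist_norm)
    qed
    finally show ?thesis .
  qed
  then show ?thesis by blast
qed

text \<open>Averaging \<open>\<phi> (x + y)\<close> over a grid in \<open>x\<close> and another one in \<open>y\<close> is close to both averages.\<close>

lemma gmean_convergent:
  fixes \<phi> :: "real ^ 'd \<Rightarrow> complex"
  assumes per: "torus_periodic \<phi>" and cont: "continuous_on UNIV \<phi>"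
  shows "convergent (\<lambda>q. gmean q \<phi>)"
proof (rule Cauchy_convergent, rule metric_CauchyI)
  fix e :: real assume e: "e > 0"
  obtain Q where Q: "\<And>q \<tau>. q \<ge> Q \<Longrightarrow> norm (gmean q (\<lambda>x. \<phi> (x + \<tau>)) - gmean q \<phi>) \<le> e / 3"
    using gmean_translate[OF per cont, of "e/3"] e by auto
  have key: "norm (gmean q (\<lambda>y. gmean q' (\<lambda>x. \<phi> (x + y))) - gmean q' \<phi>) \<le> e / 3"
    if "q > 0" "q' \<ge> Q" for q q'
  proof -
    have "gmean q (\<lambda>y. gmean q' (\<lambda>x. \<phi> (x + y))) - gmean q' \<phi>
        = gmean q (\<lambda>y. gmean q' (\<lambda>x. \<phi> (x + y)) - gmean q' \<phi>)"
      by (simp add: gmean_diff gmean_const[OF that(1)])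
    also have "norm \<dots> \<le> e / 3" by (rule norm_gmean_le) (rule Q[OF that(2)])
    finally show ?thesis .
  qed
  have "dist (gmean q \<phi>) (gmean q' \<phi>) < e" if "q \<ge> Suc Q" "q' \<ge> Suc Q" for q q'
  proof -
    have "gmean q (\<lambda>y. gmean q' (\<lambda>x. \<phi> (x + y))) = gmean q' (\<lambda>y. gmean q (\<lambda>x. \<phi> (x + y)))"
      by (subst gmean_swap) (simp add: add.commute)
    with key[of q q'] key[of q' q] that
    show ?thesis
      using dist_triangle3[of "gmean q \<phi>" "gmean q' \<phi>" "gmean q (\<lambda>y. gmean q' (\<lambda>x. \<phi> (x + y)))"] e
      by (simp add: dist_norm)
  qed
  then show "\<exists>M. \<forall>m\<ge>M. \<forall>n\<ge>M. dist (gmean m \<phi>) (gmean n \<phi>) < e" by blast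
qed

text \<open>The discrete Fourier coefficient of the translate f(\<theta> + x). It approximates the
  whole n-th term of the Fourier series at \<theta>, not just the coefficient, so inversion recovers
  f at an arbitrary \<theta> and not only at grid nodes.\<close>

definition dft :: "nat \<Rightarrow> (real ^ 'd \<Rightarrow> complex) \<Rightarrow> real ^ 'd \<Rightarrow> int ^ 'd \<Rightarrow> complex" where
  "dft q f \<theta> n = gmean q (\<lambda>x. f (\<theta> + x) * cis (- (2 * pi * (int_vec n \<bullet> x))))"

lemma torus_periodic_cis_minus: "torus_periodic (\<lambda>x. cis (- (2 * pi * (int_vec n \<bullet> x))))"
  using torus_periodic_cis[of n] unfolding torus_periodic_def cis_cnj[symmetric] by simp

lemma torus_periodic_times_cis:
  "torus_periodic f \<Longrightarrow> torus_periodic (\<lambda>x. f (\<theta> + x) * cis (- (2 * pi * (int_vec n \<bullet> x))))"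
  using torus_periodic_cis_minus[of n] unfolding torus_periodic_def by (simp add: add.assoc[symmetric])

text \<open>Translating by \<theta> does not change the limit of grid means, so \<theta> survives
  only in the phase that the exponential picks up under the substitution.\<close>

lemma dft_limit:
  fixes f :: "real ^ 'd \<Rightarrow> complex"
  assumes per: "torus_periodic f" and cont: "continuous_on UNIV f"
  shows "\<exists>a. \<forall>n \<theta>. (\<lambda>q. dft q f \<theta> n) \<longlonglongrightarrow> a n * cis (2 * pi * (int_vec n \<bullet> \<theta>))"
proof -
  define \<phi> where "\<phi> n x = f x * cis (- (2 * pi * (int_vec n \<bullet> x)))" for n x
  have p: "torus_periodic (\<phi> n)" for n
    using torus_periodic_times_cis[OF per, of 0 n] by (simp add: \<phi>_def[abs_def])
  have c: "continuous_on UNIV (\<phi> n)" for n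
    unfolding \<phi>_def[abs_def] by (intro continuous_intros cont)
  obtain a where a: "\<And>n. (\<lambda>q. gmean q (\<phi> n)) \<longlonglongrightarrow> a n"
    using gmean_convergent[OF p c] unfolding convergent_def by metis
  have "(\<lambda>q. dft q f \<theta> n) \<longlonglongrightarrow> a n * cis (2 * pi * (int_vec n \<bullet> \<theta>))" for n \<theta>
  proof -
    have "(\<lambda>q. gmean q (\<lambda>x. \<phi> n (x + \<theta>)) - gmean q (\<phi> n)) \<longlonglongrightarrow> 0"
    proof (rule LIMSEQ_I)
      fix e :: real assume "e > 0"
      then obtain Q where "\<And>q \<tau>. q \<ge> Q \<Longrightarrow> norm (gmean q (\<lambda>x. \<phi> n (x + \<tau>)) - gmean q (\<phi> n)) \<le> e / 2"
        using gmean_translate[OF p c, of "e/2"] by (metis half_gt_zero)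
      moreover have "e / 2 < e" using \<open>e > 0\<close> by simp
      ultimately show "\<exists>no. \<forall>q\<ge>no. norm (gmean q (\<lambda>x. \<phi> n (x + \<theta>)) - gmean q (\<phi> n) - 0) < e"
        unfolding diff_zero by (meson order_le_less_trans)
    qed
    from tendsto_add[OF this a[of n]]
    have l: "(\<lambda>q. gmean q (\<lambda>x. \<phi> n (x + \<theta>))) \<longlonglongrightarrow> a n" by simp
    have "dft q f \<theta> n = cis (2 * pi * (int_vec n \<bullet> \<theta>)) * gmean q (\<lambda>x. \<phi> n (x + \<theta>))" for q
      unfolding dft_def \<phi>_def gmean_cmult[symmetric]
      by (simp add: mult.left_commute cis_mult inner_right_distrib algebra_simps)
    with tendsto_mult_left[OF l, of "cis (2 * pi * (int_vec n \<bullet> \<theta>))"]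
    show ?thesis by (simp only: mult.commute[of "a n"])
  qed
  then show ?thesis by blast
qed

text \<open>A full period of a q-th root of unity other than 1, with q = 2r + 1; the centred range
  costs only a phase.\<close>

lemma sum_cis_roots:
  fixes r :: nat and y :: int
  assumes "0 < y" "y < 2 * int r + 1"
  shows "(\<Sum>m\<in>{-int r..int r}. cis (- (2 * pi * (of_int m * (of_int y / real (2 * r + 1)))))) = 0"
proof -
  let ?q = "2 * r + 1"
  define \<zeta> where "\<zeta> = cis (- (2 * pi * (of_int y / real ?q)))"
  have "\<zeta> \<noteq> 1"
  proof
    assume "\<zeta> = 1"
    then have "cos (2 * pi * (of_int y / real ?q)) = 1" by (simp add: \<zeta>_def cis.ctr complex_eq_iff)
    then obtain k :: int where "2 * pi * (of_int y / real ?q) = of_int k * 2 * pi"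
      using cos_one_2pi_int by auto
    then have "2 * pi * (of_int y / real ?q) = 2 * pi * of_int k" by (simp only: mult_ac)
    then have "of_int y / real ?q = of_int k" by (rule mult_left_cancel[THEN iffD1, rotated]) simp
    then have "real_of_int y = real_of_int (k * int ?q)" by (simp add: field_simps)
    then have "y = k * int ?q" by (simp only: of_int_eq_iff)
    then have "int ?q dvd y" by simp
    then show False using assms zdvd_not_zless by auto
  qed
  have \<zeta>q: "\<zeta> ^ ?q = 1"
  proof -
    have "\<zeta> ^ ?q = cis (real ?q * - (2 * pi * (of_int y / real ?q)))"
      by (simp only: \<zeta>_def Complex.DeMoivre)
    also have "real ?q * - (2 * pi * (of_int y / real ?q)) = 2 * pi * of_int (- y)"
      by (simp add: field_simps)
    finally show ?thesis by (simp only: cis_2pi_int)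
  qed
  have "(\<Sum>m\<in>{-int r..int r}. cis (- (2 * pi * (of_int m * (of_int y / real ?q)))))
      = (\<Sum>k<?q. cis (- (2 * pi * (of_int (int k - int r) * (of_int y / real ?q)))))"
    by (rule sum.reindex_bij_witness[of _ "\<lambda>k. int k - int r" "\<lambda>m. nat (m + int r)"]) auto
  also have "\<dots> = (\<Sum>k<?q. cis (2 * pi * (real r * (of_int y / real ?q))) * \<zeta> ^ k)"
  proof (rule sum.cong[OF refl])
    fix k
    have "- (2 * pi * (of_int (int k - int r) * (of_int y / real ?q)))
        = 2 * pi * (real r * (of_int y / real ?q)) + real k * - (2 * pi * (of_int y / real ?q))"
      by (simp add: algebra_simps diff_divide_distrib)
    then show "cis (- (2 * pi * (of_int (int k - int r) * (of_int y / real ?q))))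
        = cis (2 * pi * (real r * (of_int y / real ?q))) * \<zeta> ^ k"
      by (simp only: \<zeta>_def Complex.DeMoivre cis_mult)
  qed
  also have "\<dots> = 0"
    unfolding sum_distrib_left[symmetric] geometric_sum[OF \<open>\<zeta> \<noteq> 1\<close>] \<zeta>q by simp
  finally show ?thesis .
qed

text \<open>There are as many frequencies as nodes, (2r + 1)^d of each. After exchanging the sums,
  the frequency sum is a kernel that vanishes at every node except 0. The odd grid size makes the
  frequency box symmetric about 0.\<close>

lemma dft_inversion:
  fixes f :: "real ^ 'd \<Rightarrow> complex"
  shows "(\<Sum>n\<in>lattice_box {-int r..int r}. dft (2 * r + 1) f \<theta> n) = f \<theta>"
proof -
  let ?q = "2 * r + 1" and ?N = "lattice_box {-int r..int r} :: (int ^ 'd) set"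
  let ?J = "lattice_box {0..<int (2 * r + 1)} :: (int ^ 'd) set"
  have inner: "(\<Sum>n\<in>?N. cis (- (2 * pi * (int_vec n \<bullet> (int_vec j /\<^sub>R real ?q)))))
      = (if j = 0 then of_nat (?q ^ CARD('d)) else 0)" if j: "j \<in> ?J" for j
  proof -
    have cs: "cis (- (2 * pi * (int_vec n \<bullet> (int_vec j /\<^sub>R real ?q))))
        = (\<Prod>i\<in>UNIV. cis (- (2 * pi * (of_int (n $ i) * (of_int (j $ i) / real ?q)))))" for n
    proof -
      have "- (2 * pi * (int_vec n \<bullet> (int_vec j /\<^sub>R real ?q)))
          = (\<Sum>i\<in>UNIV. - (2 * pi * (of_int (n $ i) * (of_int (j $ i) / real ?q))))"
        by (simp add: inner_vec_def sum_distrib_left sum_negf divide_inverse_commute)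
      then show ?thesis by (simp add: cis_conv_exp exp_sum sum_distrib_left)
    qed
    have "(\<Sum>n\<in>?N. cis (- (2 * pi * (int_vec n \<bullet> (int_vec j /\<^sub>R real ?q)))))
        = (\<Prod>i\<in>UNIV. \<Sum>m\<in>{-int r..int r}. cis (- (2 * pi * (of_int m * (of_int (j $ i) / real ?q)))))"
      unfolding cs
      by (rule sum_prod_lattice_box[where g = "\<lambda>i m. cis (- (2 * pi * (of_int m * (of_int (j $ i) / real ?q))))"]) simp
    also have "\<dots> = (if j = 0 then of_nat (?q ^ CARD('d)) else 0)"
    proof (cases "j = 0")
      case False
      then obtain i where i: "j $ i \<noteq> 0" by (auto simp: vec_eq_iff)
      moreover have "j $ i \<in> {0..<int (2 * r + 1)}" using j by (simp only: lattice_box_def mem_Collect_eq)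
      ultimately have "(\<Sum>m\<in>{-int r..int r}. cis (- (2 * pi * (of_int m * (of_int (j $ i) / real ?q))))) = 0"
        by (intro sum_cis_roots) auto
      then show ?thesis using False by (simp only: if_False) (rule prod_zero, auto)
    qed (simp add: nat_add_distrib)
    finally show ?thesis .
  qed
  have "(\<Sum>n\<in>?N. dft ?q f \<theta> n) = (\<Sum>j\<in>?J. f (\<theta> + int_vec j /\<^sub>R real ?q) *
      (\<Sum>n\<in>?N. cis (- (2 * pi * (int_vec n \<bullet> (int_vec j /\<^sub>R real ?q)))))) / of_nat (?q ^ CARD('d))"
    unfolding dft_def gmean_def sum_distrib_left sum_divide_distrib[symmetric] by (subst sum.swap) simp
  also have "(\<Sum>j\<in>?J. f (\<theta> + int_vec j /\<^sub>R real ?q) *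
      (\<Sum>n\<in>?N. cis (- (2 * pi * (int_vec n \<bullet> (int_vec j /\<^sub>R real ?q))))))
      = (\<Sum>j\<in>?J. if j = 0 then f \<theta> * of_nat (?q ^ CARD('d)) else 0)"
    by (rule sum.cong) (simp_all only: inner, auto)
  also have "\<dots> = f \<theta> * of_nat (?q ^ CARD('d))"
    by (subst sum.delta[OF finite_lattice_box]) (auto simp: lattice_box_def)
  finally show ?thesis by (simp del: of_nat_power)
qed

section \<open>Fourier series of smooth periodic functions\<close>

lemma norm_cis_minus_1: "norm (cis t - 1) = 2 * \<bar>sin (t / 2)\<bar>"
proof -
  have "(norm (cis t - 1))\<^sup>2 = (cos t - 1)\<^sup>2 + (sin t)\<^sup>2" by (simp add: cmod_power2)
  also have "\<dots> = 2 - 2 * cos t"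
    using sin_cos_squared_add[of t] by (simp add: power2_diff)
  also have "\<dots> = (2 * \<bar>sin (t / 2)\<bar>)\<^sup>2"
    using cos_double_sin[of "t / 2"] by (simp add: power_mult_distrib)
  finally have "(norm (cis t - 1))\<^sup>2 = (2 * \<bar>sin (t / 2)\<bar>)\<^sup>2" .
  then show ?thesis by (rule power2_eq_imp_eq) auto
qed

lemma jordan_sin:
  assumes "0 \<le> x" "x \<le> pi / 2"
  shows "2 * x / pi \<le> sin x"
proof -
  have "convex_on {0..pi/2} (\<lambda>x. - sin x)"
  proof (rule f''_ge0_imp_convex)
    show "((\<lambda>x. - sin x) has_real_derivative - cos x) (at x)" for x
      by (auto intro!: derivative_eq_intros)
    show "((\<lambda>x. - cos x) has_real_derivative sin x) (at x)" for x
      by (auto intro!: derivative_eq_intros)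
    show "0 \<le> sin x" if "x \<in> {0..pi/2}" for x
      using that by (intro sin_ge_zero) auto
  qed auto
  from convex_onD_Icc[OF this, of "2 * x / pi"] show ?thesis
    using assms by (auto simp: field_simps)
qed

text \<open>Translates distance to the integers into a lower bound for a divisor: subtract the
  nearest integer, then apply Jordan's inequality on [0, pi/2]. It is used for the decay of Fourier
  coefficients and for the small divisors alike.\<close>

lemma norm_cis_minus_1_ge:
  assumes "\<And>l :: int. \<delta> \<le> \<bar>\<alpha> - of_int l\<bar>"
  shows "\<delta> \<le> norm (cis (2 * pi * \<alpha>) - 1)"
proof -
  define \<beta> where "\<beta> = \<alpha> - of_int (round \<alpha>)"
  have \<beta>: "\<bar>\<beta>\<bar> \<le> 1/2" using of_int_round_abs_le[of \<alpha>] by (simp add: \<beta>_def abs_minus_commute)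
  have "cis (2 * pi * \<alpha>) = cis (2 * pi * \<beta> + 2 * pi * of_int (round \<alpha>))"
    by (simp add: \<beta>_def algebra_simps)
  also have "\<dots> = cis (2 * pi * \<beta>)" by (simp only: cis_mult[symmetric] cis_2pi_int mult_1_right)
  finally have "norm (cis (2 * pi * \<alpha>) - 1) = 2 * \<bar>sin (pi * \<beta>)\<bar>"
    by (simp add: norm_cis_minus_1)
  moreover have "\<bar>sin (pi * \<beta>)\<bar> = \<bar>sin (pi * \<bar>\<beta>\<bar>)\<bar>"
    by (simp add: abs_if)
  moreover have "2 * \<bar>\<beta>\<bar> \<le> sin (pi * \<bar>\<beta>\<bar>)"
    using jordan_sin[of "pi * \<bar>\<beta>\<bar>"] \<beta> by simp
  moreover have "\<delta> \<le> \<bar>\<beta>\<bar>" using assms by (simp add: \<beta>_def)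
  ultimately show ?thesis by linarith
qed

text \<open>The discrete counterpart of turning a derivative into multiplication by the frequency.
  The step has to be 1/q, so that the shift maps the grid to itself.\<close>

lemma dft_fdiff:
  fixes f :: "real ^ 'd \<Rightarrow> complex"
  assumes "q > 0" "torus_periodic f"
  shows "dft q (fdiff ((1 / real q) *\<^sub>R axis i 1) k f) \<theta> n = (cis (2 * pi * (of_int (n $ i) / real q)) - 1) ^ k * dft q f \<theta> n"
proof (induction k)
  case (Suc k)
  let ?u = "(1 / real q) *\<^sub>R axis i 1 :: real ^ 'd" and ?c = "cis (2 * pi * (of_int (n $ i) / real q))"
  let ?g = "fdiff ?u k f" and ?e = "\<lambda>x. cis (- (2 * pi * (int_vec n \<bullet> x)))"
  have u: "?u = int_vec (axis i 1) /\<^sub>R real q"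
    by (simp add: vec_eq_iff axis_def inverse_eq_divide)
  have nu: "int_vec n \<bullet> ?u = of_int (n $ i) / real q"
    by (simp add: inner_axis)
  have "?g (\<theta> + x + ?u) * ?e x = ?c * (?g (\<theta> + (x + ?u)) * ?e (x + ?u))" for x
  proof -
    have e: "?c * ?e (x + ?u) = ?e x"
      unfolding inner_right_distrib nu by (simp add: cis_mult algebra_simps)
    have "?g (\<theta> + x + ?u) * ?e x = ?g (\<theta> + (x + ?u)) * (?c * ?e (x + ?u))"
      by (simp only: e add.assoc)
    then show ?thesis by (simp only: mult_ac)
  qed
  then have "(\<lambda>x. fdiff ?u (Suc k) f (\<theta> + x) * ?e x)
      = (\<lambda>x. ?c * (?g (\<theta> + (x + ?u)) * ?e (x + ?u)) - ?g (\<theta> + x) * ?e x)"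
    by (intro ext) (simp only: fdiff.simps left_diff_distrib)
  then have "dft q (fdiff ?u (Suc k) f) \<theta> n
      = gmean q (\<lambda>x. ?c * (?g (\<theta> + (x + ?u)) * ?e (x + ?u)) - ?g (\<theta> + x) * ?e x)"
    by (simp only: dft_def)
  also have "\<dots> = ?c * gmean q (\<lambda>x. ?g (\<theta> + (x + ?u)) * ?e (x + ?u)) - dft q ?g \<theta> n"
    by (simp only: gmean_diff gmean_cmult dft_def)
  also have "gmean q (\<lambda>x. ?g (\<theta> + (x + ?u)) * ?e (x + ?u)) = dft q ?g \<theta> n"
    unfolding dft_def
    using gmean_shift[OF assms(1) torus_periodic_times_cis[OF torus_periodic_fdiff[OF assms(2), of ?u k], of \<theta> n], of "axis i 1"]
    by (simp only: u)
  finally show ?case by (simp add: Suc algebra_simps)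
qed simp

text \<open>Differences are taken in the direction of the largest coordinate n_i, which dominates
  |n| up to the factor d. The k-th difference is O(q^(-k)) and the multiplier has modulus at least
  (|n_i|/q)^k; the powers of q cancel, so the bound is uniform in the grid size, as a majorant
  requires.\<close>

lemma dft_decay:
  fixes f :: "real ^ 'd \<Rightarrow> complex"
  assumes per: "torus_periodic f" and Cn: "Cn_on k UNIV f"
  shows "\<exists>B\<ge>0. \<forall>r \<theta>. \<forall>n\<in>lattice_box {-int r..int r}. n \<noteq> 0 \<longrightarrow>
    norm (dft (2 * r + 1) f \<theta> n) \<le> B / norm (int_vec n) ^ k"
proof -
  have "\<exists>B\<ge>0. \<forall>s x. norm (fdiff (s *\<^sub>R axis i 1) k f x) \<le> B * \<bar>s\<bar> ^ k" for i :: 'd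
    by (rule fdiff_bound[of torus_periodic])
      (use assms torus_periodic_bounded torus_periodic_frechet in auto)
  then obtain b where b: "\<And>i. b i \<ge> 0"
    "\<And>i s x. norm (fdiff (s *\<^sub>R axis i 1) k f x) \<le> b i * \<bar>s\<bar> ^ k" by metis
  define B where "B = (\<Sum>i\<in>UNIV. b i)"
  have bB: "b i \<le> B" for i unfolding B_def by (rule member_le_sum) (auto simp: b)
  have B0: "B \<ge> 0" using b bB order_trans by blast
  have "norm (dft (2 * r + 1) f \<theta> n) \<le> (B * real CARD('d) ^ k) / norm (int_vec n) ^ k"
    if n: "n \<in> lattice_box {-int r..int r}" "n \<noteq> 0" for r \<theta> n
  proof -
    let ?q = "2 * r + 1"
    obtain i where i: "\<And>j. \<bar>n $ j\<bar> \<le> \<bar>n $ i\<bar>"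
    proof -
      have "Max (range (\<lambda>j. \<bar>n $ j\<bar>)) \<in> range (\<lambda>j. \<bar>n $ j\<bar>)" by (intro Max_in) auto
      then obtain i where "\<bar>n $ i\<bar> = Max (range (\<lambda>j. \<bar>n $ j\<bar>))" by force
      then show ?thesis by (intro that[of i]) simp
    qed
    obtain j where "n $ j \<noteq> 0" using n(2) by (auto simp: vec_eq_iff)
    with i[of j] have ni: "\<bar>n $ i\<bar> > 0" by linarith
    let ?x = "\<bar>real_of_int (n $ i)\<bar>"
    have x0: "?x > 0" using ni by linarith
    have "norm (int_vec n) \<le> (\<Sum>j\<in>UNIV. \<bar>int_vec n $ j\<bar>)" by (rule norm_le_l1_cart)
    also have "\<dots> \<le> (\<Sum>j\<in>(UNIV :: 'd set). ?x)"
    proof (rule sum_mono)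
      fix j
      have "real_of_int \<bar>n $ j\<bar> \<le> real_of_int \<bar>n $ i\<bar>" using i[of j] by (simp only: of_int_le_iff)
      then show "\<bar>int_vec n $ j\<bar> \<le> ?x" by simp
    qed
    finally have nrm: "norm (int_vec n) \<le> real CARD('d) * ?x" by simp
    have "\<bar>n $ i\<bar> \<le> int r" using n(1) by (auto simp: lattice_box_def abs_le_iff minus_le_iff)
    then have xr: "?x \<le> real r" by linarith
    \<comment> \<open>No aliasing: |n_i| \<le> r and q = 2r + 1, so no integer is closer to n_i/q
      than 0.\<close>
    have "?x / real ?q \<le> norm (cis (2 * pi * (of_int (n $ i) / real ?q)) - 1)"
    proof (rule norm_cis_minus_1_ge)
      fix l :: int
      have "?x \<le> \<bar>of_int (n $ i) - of_int l * real ?q\<bar>"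
      proof (cases "l = 0")
        case False
        then have "1 \<le> \<bar>real_of_int l\<bar>" by linarith
        then have "real ?q \<le> \<bar>of_int l * real ?q\<bar>" by (simp add: abs_mult mult_le_cancel_right)
        then have "2 * real r + 1 \<le> \<bar>of_int l * real ?q\<bar>" by simp
        moreover have "\<bar>a\<bar> \<le> \<bar>a - b\<bar>" if "\<bar>a\<bar> \<le> real r" "2 * real r + 1 \<le> \<bar>b\<bar>" for a b
          using that by linarith
        ultimately show ?thesis using xr by blast
      qed simp
      also have "\<dots> = \<bar>of_int (n $ i) / real ?q - of_int l\<bar> * real ?q"
      proof -
        have "(of_int (n $ i) / real ?q - of_int l) * real ?q = of_int (n $ i) - of_int l * real ?q"
          by (simp add: left_diff_distrib)
        then show ?thesis by (simp only: abs_mult abs_of_nat flip: \<open>_ = of_int (n $ i) - of_int l * real ?q\<close>)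
      qed
      finally show "?x / real ?q \<le> \<bar>of_int (n $ i) / real ?q - of_int l\<bar>"
        by (simp add: divide_le_eq)
    qed
    then have "(?x / real ?q) ^ k * norm (dft ?q f \<theta> n)
        \<le> norm (cis (2 * pi * (of_int (n $ i) / real ?q)) - 1) ^ k * norm (dft ?q f \<theta> n)"
      by (intro mult_right_mono power_mono) auto
    also have "\<dots> = norm (dft ?q (fdiff ((1 / real ?q) *\<^sub>R axis i 1) k f) \<theta> n)"
      by (subst dft_fdiff[OF _ per]) (simp, simp only: norm_mult norm_power)
    also have "\<dots> \<le> b i * (1 / real ?q) ^ k"
      unfolding dft_def using b(2)[of "1 / real ?q" i]
      by (intro norm_gmean_le) (simp add: norm_mult)
    also have "\<dots> \<le> B * (1 / real ?q) ^ k" by (intro mult_right_mono bB) auto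
    finally have "norm (dft ?q f \<theta> n) * ?x ^ k \<le> B"
      by (simp add: power_divide field_simps)
    then have "norm (dft ?q f \<theta> n) \<le> B / ?x ^ k" using x0 by (simp add: field_simps)
    also have "\<dots> \<le> B / (norm (int_vec n) / real CARD('d)) ^ k"
      using nrm n(2) B0 ni
      by (intro divide_left_mono power_mono mult_pos_pos zero_less_power divide_pos_pos) (auto simp: field_simps)
    finally show ?thesis by (simp add: power_divide)
  qed
  then show ?thesis using B0 by (intro exI[of _ "B * real CARD('d) ^ k"]) auto
qed

theorem fourier_series_Cn:
  fixes f :: "real ^ 'd \<Rightarrow> complex"
  assumes per: "torus_periodic f" and Cn: "Cn_on k UNIV f" and k: "CARD('d) < k"
  shows "\<exists>a B. (\<forall>n. n \<noteq> 0 \<longrightarrow> norm (a n) \<le> B / norm (int_vec n) ^ k) \<and>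
    (\<forall>\<theta>. ((\<lambda>n. a n * cis (2 * pi * (int_vec n \<bullet> \<theta>))) has_sum f \<theta>) UNIV)"
proof -
  have cont: "continuous_on UNIV f"
    using Cn by (induction k) (auto dest: Cn_on_Suc_imp simp del: Cn_on.simps(2))
  obtain a where a: "\<And>n \<theta>. (\<lambda>q. dft q f \<theta> n) \<longlonglongrightarrow> a n * cis (2 * pi * (int_vec n \<bullet> \<theta>))"
    using dft_limit[OF per cont] by blast
  obtain B where B: "B \<ge> 0" "\<And>r \<theta> n. n \<in> lattice_box {-int r..int r} \<Longrightarrow> n \<noteq> 0 \<Longrightarrow>
      norm (dft (2 * r + 1) f \<theta> n) \<le> B / norm (int_vec n) ^ k"
    using dft_decay[OF per Cn] by metis
  obtain B0 where B0: "\<And>x. norm (f x) \<le> B0"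
    using torus_periodic_bounded[OF per cont] by (auto simp: bounded_iff)
  have B00: "B0 \<ge> 0" using B0 norm_ge_zero order_trans by blast
  \<comment> \<open>The decay estimate says nothing about n = 0, where the \<open>powr\<close> term
    is 0; there the sup bound \<open>B0\<close> of f serves as majorant.\<close>
  let ?D = "\<lambda>n :: int ^ 'd. (if n = 0 then B0 else 0) + B * norm (int_vec n) powr - real k"
  have lim: "(\<lambda>r. dft (2 * r + 1) f \<theta> n) \<longlonglongrightarrow> a n * cis (2 * pi * (int_vec n \<bullet> \<theta>))" for \<theta> n
    using LIMSEQ_subseq_LIMSEQ[OF a, of "\<lambda>r. 2 * r + 1"] by (simp add: strict_mono_def o_def)
  have inb: "eventually (\<lambda>r. n \<in> lattice_box {-int r..int r}) sequentially" for n :: "int ^ 'd"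
  proof (rule eventually_sequentiallyI)
    fix r assume r: "nat (\<Sum>i\<in>UNIV. \<bar>n $ i\<bar>) \<le> r"
    have "\<bar>n $ i\<bar> \<le> int r" for i
    proof -
      have "\<bar>n $ i\<bar> \<le> (\<Sum>i\<in>UNIV. \<bar>n $ i\<bar>)" by (rule member_le_sum) auto
      then show ?thesis using r by linarith
    qed
    then have "- int r \<le> n $ i \<and> n $ i \<le> int r" for i by (smt (verit))
    then show "n \<in> lattice_box {-int r..int r}" by (simp add: lattice_box_def)
  qed
  have bd: "norm (dft (2 * r + 1) f \<theta> n) \<le> ?D n" if "n \<in> lattice_box {-int r..int r}" for r \<theta> n
  proof (cases "n = 0")
    case True
    then show ?thesis unfolding dft_def using B0 B00 by (auto intro!: norm_gmean_le simp: norm_mult)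
  next
    case False
    then show ?thesis using B(2)[OF that False, of \<theta>] by (simp add: powr_minus powr_realpow divide_inverse)
  qed
  have "(\<lambda>n :: int ^ 'd. norm (int_vec n) powr - real k) summable_on UNIV"
    using k by (intro summable_on_lattice_powr) simp
  then have "(\<lambda>n :: int ^ 'd. B * norm (int_vec n) powr - real k) summable_on UNIV"
    by (rule summable_on_cmult_right)
  moreover have "(\<lambda>n :: int ^ 'd. if n = 0 then B0 else 0) summable_on UNIV"
    by (rule finite_nonzero_values_imp_summable_on) (auto intro: finite_subset[of _ "{0}"])
  ultimately have D: "?D summable_on UNIV" by (intro summable_on_add)
  have hs: "((\<lambda>n. a n * cis (2 * pi * (int_vec n \<bullet> \<theta>))) has_sum f \<theta>) UNIV" for \<theta>
    by (rule has_sum_tannery[OF D _ inb bd lim dft_inversion]) simp_all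
  have "norm (a n) \<le> B / norm (int_vec n) ^ k" if "n \<noteq> 0" for n
  proof -
    have l: "(\<lambda>r. norm (dft (2 * r + 1) f 0 n)) \<longlonglongrightarrow> norm (a n)"
      using tendsto_norm[OF lim[of 0 n]] by simp
    show ?thesis
      by (rule tendsto_upperbound[OF l]) (use inb[of n] B(2)[OF _ that] in \<open>auto elim: eventually_mono\<close>)
  qed
  with hs show ?thesis by blast
qed

section \<open>Exponential sums with bump weights\<close>

lemma smooth_bump_continuous: "smooth_bump w \<Longrightarrow> continuous_on UNIV w"
  unfolding smooth_bump_def Ck_on_def by (metis Cn_on.simps(1) enat_ord_code(3))

text \<open>The definition makes w vanish only outside the closed interval; the values at 0 and 1
  follow by continuity from outside. They allow sums over nodes to be extended to both
  endpoints.\<close>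

lemma smooth_bump_eq_0:
  assumes "smooth_bump w" "x \<le> 0 \<or> 1 \<le> x"
  shows "w x = 0"
proof -
  have out: "w y = 0" if "y < 0 \<or> 1 < y" for y
    using assms(1) that by (auto simp: smooth_bump_def)
  have l: "(\<lambda>n. w (a + b / real (Suc n))) \<longlonglongrightarrow> w a" for a b
  proof -
    have "(\<lambda>n. a + b * inverse (real (Suc n))) \<longlonglongrightarrow> a + b * 0"
      by (intro tendsto_intros LIMSEQ_inverse_real_of_nat)
    then have "(\<lambda>n. a + b / real (Suc n)) \<longlonglongrightarrow> a" by (simp add: divide_inverse)
    moreover have "isCont w a"
      using smooth_bump_continuous[OF assms(1)] continuous_on_eq_continuous_at by blast
    ultimately show ?thesis by (rule isCont_tendsto_compose[rotated])
  qed
  have "w 0 = 0"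
    using l[of 0 "-1"] by (simp add: out LIMSEQ_const_iff)
  moreover have "w 1 = 0"
    using l[of 1 1] by (simp add: out LIMSEQ_const_iff)
  ultimately show ?thesis using assms(2) out[of x] by (metis order_le_less)
qed

lemma smooth_bump_fdiff:
  assumes "smooth_bump w"
  shows "\<exists>B\<ge>0. \<forall>s x. \<bar>fdiff s k w x\<bar> \<le> B * \<bar>s\<bar> ^ k"
proof -
  let ?P = "\<lambda>f :: real \<Rightarrow> real. \<forall>x. x \<notin> {0..1} \<longrightarrow> f x = 0"
  have "\<exists>B\<ge>0. \<forall>s x. norm (fdiff (s *\<^sub>R 1) k w x) \<le> B * \<bar>s\<bar> ^ k"
  proof (rule fdiff_bound[of ?P])
    fix f :: "real \<Rightarrow> real" assume f: "?P f" "continuous_on UNIV f"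
    have "compact (f ` {0..1})"
      by (intro compact_continuous_image continuous_on_subset[OF f(2)]) auto
    then have "bounded (insert 0 (f ` {0..1}))" by (auto intro: compact_imp_bounded)
    moreover have "range f \<subseteq> insert 0 (f ` {0..1})"
    proof clarify
      fix x assume "f x \<notin> f ` {0..1}"
      then have "x \<notin> {0..1}" by blast
      then show "f x = 0" using f(1) by simp
    qed
    ultimately show "bounded (range f)" by (rule bounded_subset)
  next
    fix f :: "real \<Rightarrow> real" assume f: "?P f"
    show "?P (\<lambda>x. frechet_derivative f (at x) 1)"
    proof (intro allI impI)
      fix x :: real assume x: "x \<notin> {0..1}"
      have "(f has_derivative (\<lambda>_. 0)) (at x)"
        by (rule has_derivative_transform_within_open[of "\<lambda>_. 0" _ _ _ "- {0..1}"]) (use f x in auto)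
      from frechet_derivative_eqI[OF this] show "frechet_derivative f (at x) 1 = 0" .
    qed
  next
    show "Cn_on k UNIV w" using assms by (simp add: smooth_bump_def Ck_on_def)
  qed (use assms in \<open>auto simp: smooth_bump_def\<close>)
  then show ?thesis by simp
qed

text \<open>At least half as many nodes as there are in total lie in [1/4, 3/4], where w is bounded
  below by its positive minimum. So the normalising sum grows linearly in N.\<close>

lemma sum_bump_ge:
  assumes "smooth_bump w"
  shows "\<exists>\<delta>>0. \<forall>N. \<delta> * real N \<le> (\<Sum>j<N. w (real (j + 1) / real (N + 1)))"
proof -
  have "continuous_on {1/4..3/4} w" using smooth_bump_continuous[OF assms] continuous_on_subset by blast
  then obtain x0 where x0: "x0 \<in> {1/4..3/4}" "\<And>y. y \<in> {1/4..3/4} \<Longrightarrow> w x0 \<le> w y"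
    using continuous_attains_inf[of "{1/4..3/4 :: real}" w] by auto
  have pos: "w x0 > 0" using x0(1) assms by (auto simp: smooth_bump_def)
  have w0: "w y \<ge> 0" for y
    using assms smooth_bump_eq_0[OF assms, of y] unfolding smooth_bump_def
    by (cases "y \<in> {0<..<1}") (auto simp: less_imp_le)
  have "w x0 / 2 * real N \<le> (\<Sum>j<N. w (real (j + 1) / real (N + 1)))" for N
  proof (cases "N = 0")
    case False
    let ?n = "N + 1"
    \<comment> \<open>The indices j with 1/4 \<le> (j+1)/(N+1) \<le> 3/4: adding 3 rounds the
      quarter up, and the subtracted 1 comes from j + 1.\<close>
    let ?I = "{(?n + 3) div 4 - 1..<3 * ?n div 4}"
    have sub: "?I \<subseteq> {..<N}" using False by auto
    have "real N / 2 \<le> real (card ?I)"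
    proof -
      have "(?n + 3) div 4 \<ge> 1" "(?n + 3) div 4 \<le> 3 * ?n div 4 + 1" by presburger+
      then have "card ?I = 3 * ?n div 4 + 1 - (?n + 3) div 4" by simp
      moreover have "N \<le> 2 * (3 * ?n div 4 + 1 - (?n + 3) div 4)"
      proof -
        have "4 * ((?n + 3) div 4) \<le> ?n + 3" by simp
        moreover have "3 * ?n \<le> 4 * (3 * ?n div 4) + 3"
          using mult_div_mod_eq[of 4 "3 * ?n"] mod_less_divisor[of 4 "3 * ?n"] by linarith
        moreover have "N \<le> 2 * (b + 1 - a)" if "4 * a \<le> ?n + 3" "3 * ?n \<le> 4 * b + 3" for a b :: nat
          using that by arith
        ultimately show ?thesis by blast
      qed
      ultimately have "N \<le> 2 * card ?I" by metis
      then show ?thesis by linarith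
    qed
    then have "w x0 / 2 * real N \<le> (\<Sum>j\<in>?I. w x0)" using pos by (simp add: mult.commute)
    also have "\<dots> \<le> (\<Sum>j\<in>?I. w (real (j + 1) / real (N + 1)))"
    proof (rule sum_mono)
      fix j assume "j \<in> ?I"
      then have "(?n + 3) div 4 \<le> j + 1" "j + 1 \<le> 3 * ?n div 4" by auto
      moreover have "?n + 3 < 4 + 4 * ((?n + 3) div 4)" by (rule dividend_less_times_div) simp
      moreover have "4 * (3 * ?n div 4) \<le> 3 * ?n" by simp
      moreover have "n \<le> 4 * i \<and> 4 * i \<le> 3 * n"
        if "a \<le> i" "i \<le> b" "n + 3 < 4 + 4 * a" "4 * b \<le> 3 * n" for a b i n :: nat
        using that by linarith
      ultimately have "?n \<le> 4 * (j + 1)" "4 * (j + 1) \<le> 3 * ?n" by blast+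
      then have "real ?n \<le> 4 * real (j + 1)" "4 * real (j + 1) \<le> 3 * real ?n" by linarith+
      then show "w x0 \<le> w (real (j + 1) / real (N + 1))"
        by (intro x0(2)) (auto simp: field_simps)
    qed
    also have "\<dots> \<le> (\<Sum>j<N. w (real (j + 1) / real (N + 1)))"
      by (rule sum_mono2) (use sub w0 in auto)
    finally show ?thesis .
  qed simp
  then show ?thesis using pos by (intro exI[of _ "w x0 / 2"]) auto
qed

lemma bump_weight_pos:
  assumes "smooth_bump w" "k < N"
  shows "0 < bump_weight w N k"
proof -
  have p: "0 < w (real (k + 1) / real (N + 1))" if "k < N" for k
    using assms(1) that by (auto simp: smooth_bump_def)
  then have "0 < (\<Sum>j<N. w (real (j + 1) / real (N + 1)))"
    using assms(2) by (intro sum_pos) auto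
  then show ?thesis using p[OF assms(2)] by (simp add: bump_weight_def)
qed

lemma sum_bump_weight:
  assumes "smooth_bump w" "N \<ge> 1"
  shows "(\<Sum>k<N. bump_weight w N k) = 1"
proof -
  have p: "0 < w (real (k + 1) / real (N + 1))" if "k < N" for k
    using assms(1) that by (auto simp: smooth_bump_def)
  have "0 < (\<Sum>j<N. w (real (j + 1) / real (N + 1)))"
    by (rule sum_pos) (use p assms(2) in \<open>auto simp: lessThan_empty_iff\<close>)
  then show ?thesis unfolding bump_weight_def sum_distrib_left[symmetric] by simp
qed

text \<open>The j-th forward difference at x looks at x, x + s, ..., x + j s, so the support grows
  by j s, to the left only.\<close>

lemma fdiff_eq_0_outside:
  assumes "\<And>y. y < 0 \<or> 1 < y \<Longrightarrow> w y = 0" "s \<ge> 0" "x < - real j * s \<or> 1 < x"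
  shows "fdiff s j w x = 0"
  using assms(3)
proof (induction j arbitrary: x)
  case (Suc j)
  have "fdiff s j w (x + s) = 0" "fdiff s j w x = 0"
    using Suc.prems assms(2) by (intro Suc.IH; auto simp: algebra_simps)+
  then show ?case by simp
qed (use assms(1) in auto)

text \<open>Each difference can be moved onto the exponential, where it becomes the factor
  \<open>cis (- (2 * pi * \<alpha>)) - 1\<close>. The summation range has a margin of
  \<open>L\<close> nodes to the left of 0, enough for \<open>L\<close> differences without boundary
  terms.\<close>

lemma summation_by_parts_fdiff:
  fixes w :: "real \<Rightarrow> real" and N L :: nat
  defines "s \<equiv> 1 / real (N + 1)"
  assumes out: "\<And>y. y < 0 \<or> 1 < y \<Longrightarrow> w y = 0" and "j \<le> L"
  shows "(\<Sum>k\<in>{- int L..int N + 1}. of_real (fdiff s j w (of_int k * s)) * cis (2 * pi * (of_int k * \<alpha>)))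
    = (cis (- (2 * pi * \<alpha>)) - 1) ^ j * (\<Sum>k\<in>{- int L..int N + 1}. of_real (w (of_int k * s)) * cis (2 * pi * (of_int k * \<alpha>)))"
  using \<open>j \<le> L\<close>
proof (induction j)
  case (Suc j)
  let ?I = "{- int L..int N + 1}" and ?e = "\<lambda>k :: int. cis (2 * pi * (of_int k * \<alpha>))"
  let ?c = "cis (- (2 * pi * \<alpha>))"
  define f where "f k = complex_of_real (fdiff s j w (of_int k * s))" for k :: int
  have s0: "s > 0" by (simp add: s_def)
  \<comment> \<open>On the left the support of the j-th difference reaches down to -j s only, and j
    < L; on the right (N + 2) s > 1. Hence the index shift below loses and gains nothing.\<close>
  have f0: "f k = 0" if "k = - int L \<or> k = int N + 2" for k
  proof -
    have "real_of_int k * s < - real j * s \<or> 1 < real_of_int k * s"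
    proof (cases "k = - int L")
      case True
      then have "real_of_int k < - real j" using Suc.prems by simp
      then show ?thesis using s0 by (intro disjI1 mult_strict_right_mono) auto
    next
      case False
      then show ?thesis using that by (simp add: s_def field_simps)
    qed
    then show ?thesis using fdiff_eq_0_outside[of w s "of_int k * s" j] out s0 by (simp add: f_def)
  qed
  have "(\<Sum>k\<in>?I. f (k + 1) * ?e k) = (\<Sum>k\<in>{- int L + 1..int N + 2}. f k * ?e (k - 1))"
    by (rule sum.reindex_bij_witness[of _ "\<lambda>k. k - 1" "\<lambda>k. k + 1"]) auto
  also have "\<dots> = (\<Sum>k\<in>{- int L..int N + 2}. f k * ?e (k - 1))"
    by (rule sum.mono_neutral_left) (auto intro!: f0)
  also have "\<dots> = (\<Sum>k\<in>?I. f k * ?e (k - 1))"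
    by (rule sum.mono_neutral_right) (auto intro!: f0)
  also have "\<dots> = ?c * (\<Sum>k\<in>?I. f k * ?e k)"
    unfolding sum_distrib_left
  proof (rule sum.cong[OF refl])
    fix k
    have "?e (k - 1) = ?c * ?e k" by (simp add: cis_mult algebra_simps)
    then show "f k * ?e (k - 1) = ?c * (f k * ?e k)" by (simp only: mult_ac)
  qed
  finally have "(\<Sum>k\<in>?I. f (k + 1) * ?e k) = ?c * (\<Sum>k\<in>?I. f k * ?e k)" .
  moreover have "(\<Sum>k\<in>?I. of_real (fdiff s (Suc j) w (of_int k * s)) * ?e k)
      = (\<Sum>k\<in>?I. f (k + 1) * ?e k) - (\<Sum>k\<in>?I. f k * ?e k)"
    unfolding sum_subtractf[symmetric]
    by (rule sum.cong) (simp_all add: f_def left_diff_distrib distrib_right)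
  ultimately have "(\<Sum>k\<in>?I. of_real (fdiff s (Suc j) w (of_int k * s)) * ?e k)
      = (?c - 1) * (\<Sum>k\<in>?I. f k * ?e k)" by (simp only: left_diff_distrib mult_1_left)
  also have "(\<Sum>k\<in>?I. f k * ?e k) = (?c - 1) ^ j * (\<Sum>k\<in>?I. of_real (w (of_int k * s)) * ?e k)"
    unfolding f_def using Suc by simp
  finally show ?case by (simp only: power_Suc mult.assoc)
qed simp

text \<open>After m differences each summand is O(N^(-m)). The number N + m + 2 of summands is at
  most (m + 3) N, and the normalising sum is at least d N, so the two factors N cancel. Each of the
  m multipliers has modulus at least \<delta>.\<close>

lemma bump_weight_exp_sum:
  assumes w: "smooth_bump w"
  obtains C where "C \<ge> 0" "\<And>N \<alpha> \<delta>. N \<ge> 1 \<Longrightarrow> 0 < \<delta> \<Longrightarrow> (\<And>l::int. \<delta> \<le> \<bar>\<alpha> - of_int l\<bar>) \<Longrightarrow>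
    norm (\<Sum>k<N. of_real (bump_weight w N k) * cis (2 * pi * (real k * \<alpha>))) \<le> C / (real N ^ m * \<delta> ^ m)"
proof -
  obtain B where B: "B \<ge> 0" "\<And>s x. \<bar>fdiff s m w x\<bar> \<le> B * \<bar>s\<bar> ^ m"
    using smooth_bump_fdiff[OF w] by metis
  obtain d where d: "d > 0" "\<And>N. d * real N \<le> (\<Sum>j<N. w (real (j + 1) / real (N + 1)))"
    using sum_bump_ge[OF w] by metis
  have out: "w y = 0" if "y < 0 \<or> 1 < y" for y
    using smooth_bump_eq_0[OF w, of y] that by auto
  have "norm (\<Sum>k<N. of_real (bump_weight w N k) * cis (2 * pi * (real k * \<alpha>)))
      \<le> (B * real (m + 3) / d) / (real N ^ m * \<delta> ^ m)"
    if N: "N \<ge> 1" and \<delta>: "0 < \<delta>" "\<And>l::int. \<delta> \<le> \<bar>\<alpha> - of_int l\<bar>" for N \<alpha> \<delta>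
  proof -
    define s where "s = 1 / real (N + 1)"
    let ?I = "{- int m..int N + 1}" and ?e = "\<lambda>k :: int. cis (2 * pi * (of_int k * \<alpha>))"
    define S where "S = (\<Sum>k\<in>?I. of_real (w (of_int k * s)) * ?e k)"
    define W where "W = (\<Sum>j<N. w (real (j + 1) / real (N + 1)))"
    have W: "d * real N \<le> W" using d(2) by (simp add: W_def)
    have W0: "W > 0" using W d(1) N by (smt (verit) mult_pos_pos of_nat_0_less_iff less_le_trans zero_less_one)
    have "\<delta> \<le> norm (cis (2 * pi * (- \<alpha>)) - 1)"
      by (rule norm_cis_minus_1_ge) (metis \<delta>(2) abs_minus_commute minus_diff_commute of_int_minus)
    then have "\<delta> ^ m * norm S \<le> norm (cis (- (2 * pi * \<alpha>)) - 1) ^ m * norm S"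
      using \<delta>(1) by (intro mult_right_mono power_mono) auto
    also have "\<dots> = norm (\<Sum>k\<in>?I. of_real (fdiff s m w (of_int k * s)) * ?e k)"
      unfolding S_def s_def by (subst summation_by_parts_fdiff[OF out]) (auto simp: norm_mult norm_power)
    also have "\<dots> \<le> real (card ?I) * (B * s ^ m)"
    proof (rule sum_norm_bound)
      fix k
      show "norm (of_real (fdiff s m w (of_int k * s)) * ?e k) \<le> B * s ^ m"
        using B(2)[of s "of_int k * s"] by (simp add: norm_mult s_def)
    qed
    also have "\<dots> \<le> (real (m + 3) * real N) * (B * (1 / real N) ^ m)"
    proof (intro mult_mono power_mono)
      have "m + 2 \<le> (m + 2) * N" using mult_le_mono2[OF N, of "m + 2"] by simp
      then have "N + m + 2 \<le> (m + 3) * N" by (simp add: algebra_simps)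
      moreover have "card ?I = N + m + 2" by simp
      ultimately show "real (card ?I) \<le> real (m + 3) * real N" by (metis of_nat_le_iff of_nat_mult)
      show "s \<le> 1 / real N" using N by (simp add: s_def field_simps)
    qed (use B(1) in \<open>auto simp: s_def\<close>)
    finally have S: "\<delta> ^ m * norm S \<le> real (m + 3) * real N * B / real N ^ m"
      by (simp add: power_divide)
    have "(\<Sum>k<N. of_real (bump_weight w N k) * cis (2 * pi * (real k * \<alpha>)))
        = of_real (inverse W) * (\<Sum>k<N. of_real (w (of_int (int k + 1) * s)) * ?e (int k))"
      unfolding bump_weight_def sum_distrib_left W_def[symmetric]
      by (rule sum.cong) (simp_all add: s_def add.commute)
    also have "(\<Sum>k<N. of_real (w (of_int (int k + 1) * s)) * ?e (int k))
        = (\<Sum>k\<in>{1..int N}. of_real (w (of_int k * s)) * ?e (k - 1))"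
      by (rule sum.reindex_bij_witness[of _ "\<lambda>k. nat (k - 1)" "\<lambda>k. int k + 1"]) auto
    \<comment> \<open>The added nodes k \<le> 0 and k = N + 1 carry the value 0, since w vanishes at
      the endpoints as well; the m nodes left of 0 are the margin for m differences.\<close>
    also have "\<dots> = (\<Sum>k\<in>?I. of_real (w (of_int k * s)) * ?e (k - 1))"
    proof (rule sum.mono_neutral_left)
      show "\<forall>k\<in>?I - {1..int N}. complex_of_real (w (of_int k * s)) * ?e (k - 1) = 0"
      proof
        fix k assume "k \<in> ?I - {1..int N}"
        then have "k \<le> 0 \<or> k = int N + 1" by auto
        then have "real_of_int k * s \<le> 0 \<or> 1 \<le> real_of_int k * s"
          by (auto simp: s_def divide_nonpos_pos)
        then show "complex_of_real (w (of_int k * s)) * ?e (k - 1) = 0"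
          using smooth_bump_eq_0[OF w] by simp
      qed
    qed auto
    also have "\<dots> = cis (- (2 * pi * \<alpha>)) * S"
      unfolding S_def sum_distrib_left
    proof (rule sum.cong[OF refl])
      fix k
      have "?e (k - 1) = cis (- (2 * pi * \<alpha>)) * ?e k" by (simp add: cis_mult algebra_simps)
      then show "complex_of_real (w (of_int k * s)) * ?e (k - 1)
          = cis (- (2 * pi * \<alpha>)) * (complex_of_real (w (of_int k * s)) * ?e k)" by (simp only: mult_ac)
    qed
    finally have "norm (\<Sum>k<N. of_real (bump_weight w N k) * cis (2 * pi * (real k * \<alpha>))) = norm S / W"
      using W0 by (simp add: norm_mult norm_inverse divide_inverse mult.commute)
    also have "\<dots> \<le> norm S / (d * real N)"
      using W W0 d(1) N by (intro divide_left_mono mult_pos_pos) auto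
    also have "\<dots> \<le> (real (m + 3) * real N * B / real N ^ m / \<delta> ^ m) / (d * real N)"
    proof (rule divide_right_mono)
      show "norm S \<le> real (m + 3) * real N * B / real N ^ m / \<delta> ^ m"
        using S \<delta>(1) by (subst pos_le_divide_eq) (simp_all only: zero_less_power mult.commute[of "norm S"])
    qed (use d(1) in simp)
    also have "\<dots> = (B * real (m + 3) / d) / (real N ^ m * \<delta> ^ m)"
      using N by (simp add: mult_ac)
    finally show ?thesis .
  qed
  then show thesis using B(1) d(1) by (intro that[of "B * real (m + 3) / d"]) auto
qed

section \<open>The weighted Birkhoff average on islands\<close>

text \<open>Some integer is within distance 1 of any real, so multiples t of a unit vector force c
  t^(-\<nu>) \<le> 1 for all t \<ge> 1. Nonnegativity is what extracts k > d from k > d + m \<nu>,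
  as absolute convergence of the Fourier series requires.\<close>

lemma diophantine_nonneg:
  fixes \<omega> :: "real ^ 'd"
  assumes "diophantine c \<nu> \<omega>"
  shows "\<nu> \<ge> 0"
proof (rule ccontr)
  assume "\<not> \<nu> \<ge> 0"
  then have \<nu>: "- \<nu> > 0" by simp
  have c: "c > 0" and D: "\<And>n l. n \<noteq> 0 \<Longrightarrow> c * norm (int_vec n) powr (- \<nu>) \<le> \<bar>\<omega> \<bullet> int_vec n - of_int l\<bar>"
    using assms by (auto simp: diophantine_def)
  obtain i :: 'd where True by blast
  have "c * real (Suc t) powr (- \<nu>) \<le> 1" for t
  proof -
    let ?n = "axis i (int (Suc t)) :: int ^ 'd"
    have v: "int_vec ?n = real (Suc t) *\<^sub>R axis i 1" by (auto simp: vec_eq_iff axis_def)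
    have "?n $ i \<noteq> 0 $ i" by simp
    then have "?n \<noteq> 0" by metis
    from D[OF this, of "\<lfloor>\<omega> \<bullet> int_vec ?n\<rfloor>"]
    have "c * norm (int_vec ?n) powr (- \<nu>) \<le> 1" by linarith
    moreover have "norm (int_vec ?n) = real (Suc t)" unfolding v by simp
    ultimately show ?thesis by metis
  qed
  moreover have "filterlim (\<lambda>t. c * real (Suc t) powr (- \<nu>)) at_top sequentially"
    by (intro filterlim_tendsto_pos_mult_at_top[OF tendsto_const c]
          filterlim_compose[OF real_powr_at_top[OF \<nu>]]
          filterlim_compose[OF filterlim_real_sequentially filterlim_Suc])
  then have "eventually (\<lambda>t. c * real (Suc t) powr (- \<nu>) > 1) sequentially"
    by (auto simp: filterlim_at_top_dense)
  then obtain t where "c * real (Suc t) powr (- \<nu>) > 1"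
    using eventually_happens'[OF sequentially_bot] by blast
  ultimately show False by (metis not_le)
qed

text \<open>The roots-of-unity filter for a residue class, with a frequency \<beta> carried along.
  On the class, (k - s)/p is the integer k div p, so the phases in r disappear and frequency
  \<beta>/p in k becomes \<beta> in k div p.\<close>

lemma sum_cis_residue:
  fixes p :: nat and k s :: nat
  assumes p: "p \<ge> 1" and s: "s < p"
  shows "(\<Sum>r<p. cis (2 * pi * ((\<beta> + real r) * (real k - real s) / real p)))
    = (if k mod p = s then of_nat p * cis (2 * pi * (\<beta> * real (k div p))) else 0)"
proof (cases "k mod p = s")
  case True
  have "real k = real p * real (k div p) + real s"
    using mult_div_mod_eq[of p k] True by (metis of_nat_add of_nat_mult)
  then have e: "(\<beta> + real r) * (real k - real s) / real p = \<beta> * real (k div p) + real_of_int (int (r * (k div p)))" for r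
    using p by (simp add: field_simps)
  have "cis (2 * pi * ((\<beta> + real r) * (real k - real s) / real p)) = cis (2 * pi * (\<beta> * real (k div p)))" for r
    unfolding e distrib_left cis_mult[symmetric] cis_2pi_int by simp
  with True show ?thesis by simp
next
  case False
  define \<zeta> where "\<zeta> = cis (2 * pi * ((real k - real s) / real p))"
  have p0: "real p > 0" using p by simp
  have "\<zeta> \<noteq> 1"
  proof
    assume "\<zeta> = 1"
    then have "cos (2 * pi * ((real k - real s) / real p)) = 1" by (simp add: \<zeta>_def complex_eq_iff)
    then obtain l :: int where "2 * pi * ((real k - real s) / real p) = of_int l * 2 * pi"
      using cos_one_2pi_int by auto
    then have "2 * pi * ((real k - real s) / real p) = 2 * pi * of_int l" by (simp only: mult_ac)
    then have "(real k - real s) / real p = of_int l" by (rule mult_left_cancel[THEN iffD1, rotated]) simp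
    then have "real_of_int (int k - int s) = real_of_int (l * int p)" using p0 by (simp add: field_simps)
    then have "int k - int s = l * int p" by (simp only: of_int_eq_iff)
    then have "int k mod int p = int s mod int p" by (metis mod_eq_dvd_iff dvd_triv_right)
    then have "int (k mod p) = int s" using s by (simp add: zmod_int)
    with False show False by simp
  qed
  moreover have "\<zeta> ^ p = 1"
  proof -
    have "\<zeta> ^ p = cis (real p * (2 * pi * ((real k - real s) / real p)))"
      by (simp only: \<zeta>_def Complex.DeMoivre)
    also have "real p * (2 * pi * ((real k - real s) / real p)) = 2 * pi * of_int (int k - int s)"
      using p0 by simp
    finally show ?thesis by (simp only: cis_2pi_int)
  qed
  moreover have "cis (2 * pi * ((\<beta> + real r) * (real k - real s) / real p))
      = cis (2 * pi * (\<beta> * (real k - real s) / real p)) * \<zeta> ^ r" for r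
  proof -
    have "2 * pi * ((\<beta> + real r) * (real k - real s) / real p)
        = 2 * pi * (\<beta> * (real k - real s) / real p) + real r * (2 * pi * ((real k - real s) / real p))"
      by (simp add: algebra_simps add_divide_distrib diff_divide_distrib)
    then show ?thesis by (simp only: \<zeta>_def Complex.DeMoivre cis_mult)
  qed
  ultimately show ?thesis using False
    by (simp add: sum_distrib_left[symmetric] geometric_sum)
qed

text \<open>The contribution of island s to the weighted average of one Fourier mode, for an orbit
  that starts on island j, with islands counted from 0. Only times spent on island s count, and (k +
  j) div p is the number of rotations performed by then.\<close>

definition island_sum :: "(real \<Rightarrow> real) \<Rightarrow> nat \<Rightarrow> nat \<Rightarrow> nat \<Rightarrow> nat \<Rightarrow> real \<Rightarrow> complex" where
  "island_sum w N p j s \<beta> = (\<Sum>k<N. of_real (bump_weight w N k) *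
     (if (k + j) mod p = s then cis (2 * pi * (\<beta> * real ((k + j) div p))) else 0))"

text \<open>The residue filter expresses the sum as a mean over r < p of exponential sums of
  frequency (\<beta> + r)/p with unimodular factors. These frequencies stay \<delta>/p away from the
  integers, whence p^m in the constant. For \<beta> = 0 the term r = 0 is exactly 1 and gives 1/p,
  the share of time spent on each island; for 0 < r < p the distance is at least 1/p.\<close>

lemma island_sum_bound:
  assumes w: "smooth_bump w" and p: "p \<ge> 1"
  obtains C where "C \<ge> 0"
    "\<And>N j s \<beta> \<delta>. N \<ge> 1 \<Longrightarrow> s < p \<Longrightarrow> 0 < \<delta> \<Longrightarrow> (\<And>l::int. \<delta> \<le> \<bar>\<beta> - of_int l\<bar>) \<Longrightarrow>
      norm (island_sum w N p j s \<beta>) \<le> C / (real N ^ m * \<delta> ^ m)"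
    "\<And>N j s. N \<ge> 1 \<Longrightarrow> s < p \<Longrightarrow> norm (island_sum w N p j s 0 - 1 / of_nat p) \<le> C / real N ^ m"
proof -
  obtain C where C: "C \<ge> 0" "\<And>N \<alpha> \<delta>. N \<ge> 1 \<Longrightarrow> 0 < \<delta> \<Longrightarrow> (\<And>l::int. \<delta> \<le> \<bar>\<alpha> - of_int l\<bar>) \<Longrightarrow>
    norm (\<Sum>k<N. of_real (bump_weight w N k) * cis (2 * pi * (real k * \<alpha>))) \<le> C / (real N ^ m * \<delta> ^ m)"
    by (rule bump_weight_exp_sum[OF w, of m]) blast
  have p0: "real p > 0" using p by simp
  define C' where "C' = C * real p ^ m"
  have C'0: "C' \<ge> 0" using C by (simp add: C'_def)
  have main: "(0 < \<delta> \<longrightarrow> (\<forall>l::int. \<delta> \<le> \<bar>\<beta> - of_int l\<bar>) \<longrightarrow>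
        norm (island_sum w N p j s \<beta>) \<le> C' / (real N ^ m * \<delta> ^ m)) \<and>
      (\<beta> = 0 \<longrightarrow> norm (island_sum w N p j s \<beta> - 1 / of_nat p) \<le> C' / real N ^ m)"
    if N: "N \<ge> 1" and s: "s < p" for N j s \<beta> \<delta>
  proof -
    define G where "G = island_sum w N p j s \<beta>"
    define S where "S \<alpha> = (\<Sum>k<N. of_real (bump_weight w N k) * cis (2 * pi * (real k * \<alpha>)))" for \<alpha>
    define u where "u r = cis (2 * pi * ((\<beta> + real r) * (real j - real s) / real p))" for r :: nat
    have trm: "(if (k + j) mod p = s then cis (2 * pi * (\<beta> * real ((k + j) div p))) else 0)
        = (\<Sum>r<p. u r * cis (2 * pi * (real k * ((\<beta> + real r) / real p)))) / of_nat p" for k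
    proof -
      have "u r * cis (2 * pi * (real k * ((\<beta> + real r) / real p)))
          = cis (2 * pi * ((\<beta> + real r) * (real (k + j) - real s) / real p))" for r
        unfolding u_def cis_mult
        by (rule arg_cong[of _ _ cis]) (simp add: algebra_simps add_divide_distrib diff_divide_distrib)
      then show ?thesis using p0 by (simp only: sum_cis_residue[OF p s]) simp
    qed
    have "G = (\<Sum>k<N. \<Sum>r<p. u r * (of_real (bump_weight w N k) * cis (2 * pi * (real k * ((\<beta> + real r) / real p))))) / of_nat p"
      unfolding G_def island_sum_def trm by (simp add: sum_divide_distrib sum_distrib_left mult.left_commute)
    also have "\<dots> = (\<Sum>r<p. u r * S ((\<beta> + real r) / real p)) / of_nat p"
      unfolding S_def sum_distrib_left by (subst sum.swap) simp
    finally have G': "G = (\<Sum>r<p. u r * S ((\<beta> + real r) / real p)) / of_nat p" .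
    have nu: "norm (u r) = 1" for r by (simp add: u_def)
    have Sb: "norm (S ((\<beta> + real r) / real p)) \<le> C' / (real N ^ m * \<delta> ^ m)"
      if "\<delta> > 0" "\<And>l::int. \<delta> \<le> \<bar>\<beta> + real r - of_int l * real p\<bar>" for \<delta> r
    proof -
      have "norm (S ((\<beta> + real r) / real p)) \<le> C / (real N ^ m * (\<delta> / real p) ^ m)"
        unfolding S_def
      proof (rule C(2)[OF N])
        fix l :: int
        have "(\<beta> + real r) / real p - of_int l = (\<beta> + real r - of_int l * real p) / real p"
          using p0 by (simp add: field_simps)
        then show "\<delta> / real p \<le> \<bar>(\<beta> + real r) / real p - of_int l\<bar>"
          using that(2)[of l] p0 by (simp add: divide_right_mono)
      qed (use that p0 in auto)
      then show ?thesis using p0 by (simp add: C'_def power_divide)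
    qed
    show ?thesis
      unfolding G_def[symmetric]
    proof (intro conjI impI)
      assume \<delta>: "\<delta> > 0" "\<forall>l::int. \<delta> \<le> \<bar>\<beta> - of_int l\<bar>"
      have "norm (\<Sum>r<p. u r * S ((\<beta> + real r) / real p)) \<le> of_nat (card {..<p}) * (C' / (real N ^ m * \<delta> ^ m))"
      proof (rule sum_norm_bound)
        fix r
        have "\<delta> \<le> \<bar>\<beta> + real r - of_int l * real p\<bar>" for l :: int
          using \<delta>(2)[rule_format, of "l * int p - int r"] by (simp add: algebra_simps)
        from Sb[OF \<delta>(1) this] show "norm (u r * S ((\<beta> + real r) / real p)) \<le> C' / (real N ^ m * \<delta> ^ m)"
          by (simp add: norm_mult nu)
      qed
      then show "norm G \<le> C' / (real N ^ m * \<delta> ^ m)"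
        unfolding G' using p0 by (simp add: norm_divide field_simps)
    next
      assume \<beta>: "\<beta> = 0"
      have "S 0 = 1"
        unfolding S_def using sum_bump_weight[OF w N] by (simp flip: of_real_sum)
      moreover have "{..<p} = insert 0 {1..<p}" using p by auto
      ultimately have "G - 1 / of_nat p = (\<Sum>r\<in>{1..<p}. u r * S ((\<beta> + real r) / real p)) / of_nat p"
        unfolding G' using p0 by (simp add: \<beta> u_def add_divide_distrib)
      also have "norm \<dots> \<le> (of_nat (card {1..<p}) * (C' / (real N ^ m * 1 ^ m))) / real p"
        unfolding norm_divide norm_of_nat
      proof (intro divide_right_mono sum_norm_bound)
        fix r assume r: "r \<in> {1..<p}"
        have "1 \<le> \<bar>\<beta> + real r - of_int l * real p\<bar>" for l :: int
        proof -
          have "int r \<noteq> l * int p"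
          proof
            assume "int r = l * int p"
            then have "int p dvd int r" by simp
            then show False using r by (simp add: nat_dvd_not_less)
          qed
          then have "1 \<le> \<bar>int r - l * int p\<bar>" by linarith
          then have "1 \<le> real_of_int \<bar>int r - l * int p\<bar>" by linarith
          then show ?thesis by (simp add: \<beta>)
        qed
        from Sb[OF _ this] show "norm (u r * S ((\<beta> + real r) / real p)) \<le> C' / (real N ^ m * 1 ^ m)"
          by (simp add: norm_mult nu)
      qed simp
      also have "\<dots> \<le> (real p * (C' / real N ^ m)) / real p"
        unfolding power_one mult_1_right
        by (intro divide_right_mono mult_right_mono divide_nonneg_nonneg C'0) auto
      finally show "norm (G - 1 / of_nat p) \<le> C' / real N ^ m" using p0 by simp
    qed
  qed
  then show thesis using C'0 by (intro that[of C']) auto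
qed

lemma has_sum_sum_finite:
  fixes f :: "'i \<Rightarrow> 'a \<Rightarrow> 'b::topological_comm_monoid_add"
  assumes "\<And>i. i \<in> I \<Longrightarrow> (f i has_sum S i) A"
  shows "((\<lambda>x. \<Sum>i\<in>I. f i x) has_sum (\<Sum>i\<in>I. S i)) A"
  using assms by (induction I rule: infinite_finite_induct) (auto intro: has_sum_add)

text \<open>The starting point enters the n-th mode only through a phase of modulus 1 and the offset
  \<open>j\<close>, in which \<open>island_sum_bound\<close> is uniform. So one constant serves all
  orbits.\<close>

lemma island_average_scalar:
  fixes f :: "nat \<Rightarrow> real ^ 'd \<Rightarrow> complex" and \<omega> :: "real ^ 'd"
  assumes w: "smooth_bump w" and dio: "diophantine c \<nu> \<omega>" and p: "p \<ge> 1"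
    and per: "\<And>s. s < p \<Longrightarrow> torus_periodic (f s)" and Cn: "\<And>s. s < p \<Longrightarrow> Cn_on k UNIV (f s)"
    and k: "real CARD('d) + real m * \<nu> < real k"
  shows "\<exists>C L. \<forall>N\<ge>1. \<forall>j \<theta>. norm ((\<Sum>i<N. of_real (bump_weight w N i) *
      f ((i + j) mod p) (\<theta> + real ((i + j) div p) *\<^sub>R \<omega>)) - L) \<le> C / real N ^ m"
proof -
  have \<nu>: "\<nu> \<ge> 0" by (rule diophantine_nonneg[OF dio])
  have "real CARD('d) < real k" using k \<nu> by (smt (verit) mult_nonneg_nonneg of_nat_0_le_iff)
  then have kd: "CARD('d) < k" by simp
  have c: "c > 0" and D: "\<And>n l. n \<noteq> 0 \<Longrightarrow> c * norm (int_vec n) powr (- \<nu>) \<le> \<bar>\<omega> \<bullet> int_vec n - of_int l\<bar>"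
    using dio by (auto simp: diophantine_def)
  define P where "P s ab \<longleftrightarrow> (\<forall>n. n \<noteq> 0 \<longrightarrow> norm (fst ab n) \<le> snd ab / norm (int_vec n) ^ k) \<and>
      (\<forall>\<theta>. ((\<lambda>n. fst ab n * cis (2 * pi * (int_vec n \<bullet> \<theta>))) has_sum f s \<theta>) UNIV)"
    for s and ab :: "(int ^ 'd \<Rightarrow> complex) \<times> real"
  have "\<exists>ab. P s ab" if s: "s \<in> {..<p}" for s
  proof -
    have "s < p" using s by simp
    from fourier_series_Cn[OF per[OF this] Cn[OF this] kd] obtain a B where
      "\<forall>n. n \<noteq> 0 \<longrightarrow> norm (a n) \<le> B / norm (int_vec n) ^ k"
      "\<forall>\<theta>. ((\<lambda>n. a n * cis (2 * pi * (int_vec n \<bullet> \<theta>))) has_sum f s \<theta>) UNIV"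
      by (elim exE conjE)
    then have "P s (a, B)" by (simp add: P_def)
    then show ?thesis by (rule exI)
  qed
  then obtain ab where ab: "\<And>s. s \<in> {..<p} \<Longrightarrow> P s (ab s)" by metis
  define a where "a s = fst (ab s)" for s
  define B where "B s = snd (ab s)" for s
  have aB: "norm (a s n) \<le> B s / norm (int_vec n) ^ k" if "s < p" "n \<noteq> 0" for s n
    using ab[of s] that by (simp add: P_def a_def B_def)
  have hs: "((\<lambda>n. a s n * cis (2 * pi * (int_vec n \<bullet> \<theta>))) has_sum f s \<theta>) UNIV" if "s < p" for s \<theta>
    using ab[of s] that by (simp add: P_def a_def)
  obtain C where C: "C \<ge> 0"
    and CG: "\<And>N j s \<beta> \<delta>. N \<ge> 1 \<Longrightarrow> s < p \<Longrightarrow> 0 < \<delta> \<Longrightarrow> (\<And>l::int. \<delta> \<le> \<bar>\<beta> - of_int l\<bar>) \<Longrightarrow>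
      norm (island_sum w N p j s \<beta>) \<le> C / (real N ^ m * \<delta> ^ m)"
    and CG0: "\<And>N j s. N \<ge> 1 \<Longrightarrow> s < p \<Longrightarrow> norm (island_sum w N p j s 0 - 1 / of_nat p) \<le> C / real N ^ m"
    by (rule island_sum_bound[OF w p, of m]) blast
  \<comment> \<open>The decay left over after m small divisors.\<close>
  define t where "t = real k - real m * \<nu>"
  have t: "real CARD('d) < t" using k by (simp add: t_def)
  define A0 where "A0 = (\<Sum>s<p. norm (a s 0))"
  define A1 where "A1 = (\<Sum>s<p. \<bar>B s\<bar>) / c ^ m"
  define D where "D n = (if n = 0 then A0 else 0) + A1 * norm (int_vec n) powr - t" for n :: "int ^ 'd"
  have "(\<lambda>n :: int ^ 'd. A1 * norm (int_vec n) powr - t) summable_on UNIV"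
    by (rule summable_on_cmult_right[OF summable_on_lattice_powr[OF t]])
  moreover have "(\<lambda>n :: int ^ 'd. if n = 0 then A0 else 0) summable_on UNIV"
    by (rule finite_nonzero_values_imp_summable_on) (auto intro: finite_subset[of _ "{0}"])
  ultimately have "D summable_on UNIV" unfolding D_def by (intro summable_on_add)
  then obtain S where S: "(D has_sum S) UNIV" by (auto simp: summable_on_def)
  \<comment> \<open>Only the zero modes have a nonvanishing average, and each island gets the share
    1/p.\<close>
  define L where "L = (\<Sum>s<p. a s 0 / of_nat p)"
  have "norm ((\<Sum>i<N. of_real (bump_weight w N i) *
      f ((i + j) mod p) (\<theta> + real ((i + j) div p) *\<^sub>R \<omega>)) - L) \<le> (C * S) / real N ^ m"
    if N: "N \<ge> 1" for N j \<theta>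
  proof -
    define G where "G s n = island_sum w N p j s (\<omega> \<bullet> int_vec n)" for s n
    define H where "H n = (\<Sum>s<p. a s n * cis (2 * pi * (int_vec n \<bullet> \<theta>)) * G s n)" for n
    have "((\<lambda>n. \<Sum>i<N. of_real (bump_weight w N i) *
        (a ((i + j) mod p) n * cis (2 * pi * (int_vec n \<bullet> (\<theta> + real ((i + j) div p) *\<^sub>R \<omega>))))) has_sum
        (\<Sum>i<N. of_real (bump_weight w N i) * f ((i + j) mod p) (\<theta> + real ((i + j) div p) *\<^sub>R \<omega>))) UNIV"
      using p by (intro has_sum_sum_finite has_sum_cmult_right hs) auto
    moreover have "(\<Sum>i<N. of_real (bump_weight w N i) *
        (a ((i + j) mod p) n * cis (2 * pi * (int_vec n \<bullet> (\<theta> + real ((i + j) div p) *\<^sub>R \<omega>))))) = H n" for n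
    proof -
      have "of_real (bump_weight w N i) *
          (a ((i + j) mod p) n * cis (2 * pi * (int_vec n \<bullet> (\<theta> + real ((i + j) div p) *\<^sub>R \<omega>))))
          = (\<Sum>s<p. a s n * cis (2 * pi * (int_vec n \<bullet> \<theta>)) * (of_real (bump_weight w N i) *
          (if (i + j) mod p = s then cis (2 * pi * ((\<omega> \<bullet> int_vec n) * real ((i + j) div p))) else 0)))" for i
      proof -
        have "cis (2 * pi * (int_vec n \<bullet> (\<theta> + real ((i + j) div p) *\<^sub>R \<omega>)))
            = cis (2 * pi * (int_vec n \<bullet> \<theta>)) * cis (2 * pi * ((\<omega> \<bullet> int_vec n) * real ((i + j) div p)))"
          by (simp add: cis_mult inner_right_distrib inner_commute algebra_simps)
        moreover have "(\<Sum>s<p. a s n * cis (2 * pi * (int_vec n \<bullet> \<theta>)) * (of_real (bump_weight w N i) *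
          (if (i + j) mod p = s then cis (2 * pi * ((\<omega> \<bullet> int_vec n) * real ((i + j) div p))) else 0)))
          = (\<Sum>s<p. if (i + j) mod p = s then a s n * cis (2 * pi * (int_vec n \<bullet> \<theta>)) * (of_real (bump_weight w N i) *
           cis (2 * pi * ((\<omega> \<bullet> int_vec n) * real ((i + j) div p)))) else 0)"
          by (rule sum.cong) auto
        ultimately show ?thesis using p by (simp add: mult_ac)
      qed
      then show ?thesis
        unfolding H_def G_def island_sum_def sum_distrib_left by (subst sum.swap) simp
    qed
    ultimately have "(H has_sum (\<Sum>i<N. of_real (bump_weight w N i) *
        f ((i + j) mod p) (\<theta> + real ((i + j) div p) *\<^sub>R \<omega>))) UNIV" by simp
    \<comment> \<open>Charging \<open>L\<close> to the mode n = 0 lets a single summable majorant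
      control the whole difference.\<close>
    moreover have "((\<lambda>n :: int ^ 'd. if n = 0 then - L else 0) has_sum - L) UNIV"
      by (rule has_sum_finite_neutralI[of "{0}"]) auto
    ultimately have HL: "((\<lambda>n. H n + (if n = 0 then - L else 0)) has_sum
        ((\<Sum>i<N. of_real (bump_weight w N i) * f ((i + j) mod p) (\<theta> + real ((i + j) div p) *\<^sub>R \<omega>)) + - L)) UNIV"
      by (rule has_sum_add)
    have bd: "norm (H n + (if n = 0 then - L else 0)) \<le> C / real N ^ m * D n" for n
    proof (cases "n = 0")
      case True
      have "H n + - L = (\<Sum>s<p. a s 0 * (G s 0 - 1 / of_nat p))"
        unfolding H_def L_def True by (simp add: sum_subtractf right_diff_distrib)
      also have "norm \<dots> \<le> (\<Sum>s<p. norm (a s 0) * (C / real N ^ m))"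
      proof (rule sum_norm_le)
        fix s assume "s \<in> {..<p}"
        then have "norm (G s 0 - 1 / of_nat p) \<le> C / real N ^ m"
          using CG0[OF N, of s j] by (simp add: G_def)
        then show "norm (a s 0 * (G s 0 - 1 / of_nat p)) \<le> norm (a s 0) * (C / real N ^ m)"
          unfolding norm_mult by (intro mult_left_mono) auto
      qed
      also have "\<dots> = C / real N ^ m * D n"
        by (simp add: True D_def A0_def sum_distrib_left sum_distrib_right mult.commute)
      finally show ?thesis using True by simp
    next
      case False
      let ?x = "norm (int_vec n)"
      have x0: "?x > 0" using False by simp
      let ?d = "c * ?x powr (- \<nu>)"
      have d0: "?d > 0" using c x0 by simp
      have "norm (H n) \<le> (\<Sum>s<p. \<bar>B s\<bar> / ?x ^ k * (C / (real N ^ m * ?d ^ m)))"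
        unfolding H_def
      proof (rule sum_norm_le)
        fix s assume s: "s \<in> {..<p}"
        then have "norm (G s n) \<le> C / (real N ^ m * ?d ^ m)"
          using CG[OF N _ d0 D[OF False], of s j] by (simp add: G_def)
        moreover have "norm (a s n) \<le> \<bar>B s\<bar> / ?x ^ k"
          using aB[of s n] s False by (smt (verit) divide_right_mono lessThan_iff zero_le_power norm_ge_zero)
        ultimately show "norm (a s n * cis (2 * pi * (int_vec n \<bullet> \<theta>)) * G s n)
            \<le> \<bar>B s\<bar> / ?x ^ k * (C / (real N ^ m * ?d ^ m))"
          unfolding norm_mult norm_cis mult_1_right by (intro mult_mono) auto
      qed
      also have "\<dots> = (\<Sum>s<p. \<bar>B s\<bar>) / ?x ^ k * (C / (real N ^ m * ?d ^ m))"
        by (simp add: sum_distrib_right sum_divide_distrib)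
      also have "\<dots> = C / real N ^ m * (A1 * (1 / (?x ^ k * (?x powr - \<nu>) ^ m)))"
        by (simp add: A1_def power_mult_distrib field_simps)
      also have "1 / (?x ^ k * (?x powr - \<nu>) ^ m) = ?x powr - t"
      proof -
        have "?x ^ k * (?x powr - \<nu>) ^ m = ?x powr real k * ?x powr (- \<nu> * real m)"
        proof -
          have "(?x powr - \<nu>) ^ m = (?x powr - \<nu>) powr real m"
            using False by (intro powr_realpow[symmetric]) simp
          then show ?thesis using x0 by (simp add: powr_realpow powr_powr)
        qed
        also have "\<dots> = ?x powr t" by (simp add: t_def powr_add[symmetric] mult.commute)
        finally show ?thesis by (simp add: powr_minus divide_inverse)
      qed
      finally show ?thesis using False by (simp add: D_def)
    qed
    have "((\<lambda>n. C / real N ^ m * D n) has_sum (C / real N ^ m * S)) UNIV"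
      by (rule has_sum_cmult_right[OF S])
    from norm_infsum_le[OF HL this] bd show ?thesis by simp
  qed
  then show ?thesis by blast
qed

section \<open>Orbits on islands and the limit of vector-valued averages\<close>

lemma island_orbit:
  assumes isl: "island_dynamics M X A F X\<^sub>0 \<omega> \<mu> p z"
  shows "(F ^^ k) (z 1 \<theta>) = z (Suc (k mod p)) (\<theta> + real (k div p) *\<^sub>R \<omega>)"
proof (induction k)
  case 0
  then show ?case by simp
next
  case (Suc k)
  have p: "p \<ge> 1" and step: "\<And>j \<theta>. j \<in> {1..<p} \<Longrightarrow> F (z j \<theta>) = z (j + 1) \<theta>"
    and last: "\<And>\<theta>. F (z p \<theta>) = z 1 (\<theta> + \<omega>)"
    using isl by (auto simp: island_dynamics_def)
  show ?case
  proof (cases "Suc (k mod p) = p")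
    case True
    then have "Suc k mod p = 0" "Suc k div p = Suc (k div p)" by (simp_all add: mod_Suc div_Suc)
    with True Suc last show ?thesis by (simp add: algebra_simps)
  next
    case False
    then have "Suc k mod p = Suc (k mod p)" "Suc k div p = k div p" by (simp_all add: mod_Suc div_Suc)
    moreover have "k mod p < p" using p by simp
    with False have "Suc (k mod p) \<in> {1..<p}" by auto
    ultimately show ?thesis using Suc step by simp
  qed
qed

text \<open>A point of the i-th island is the (i-1)-st iterate of a point of the first one, so every
  orbit is a tail of an orbit that starts there; the offset \<open>j\<close> is i - 1.\<close>

lemma island_points:
  assumes isl: "island_dynamics M X A F X\<^sub>0 \<omega> \<mu> p z" and "x \<in> X\<^sub>0"
  obtains j \<theta> where "\<And>k. (F ^^ k) x = z (Suc ((k + j) mod p)) (\<theta> + real ((k + j) div p) *\<^sub>R \<omega>)"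
proof -
  obtain i \<theta> where i: "i \<in> {1..p}" "x = z i \<theta>"
    using assms by (auto simp: island_dynamics_def)
  have "x = (F ^^ (i - 1)) (z 1 \<theta>)"
  proof -
    have "(i - 1) mod p = i - 1" "(i - 1) div p = 0" "Suc (i - 1) = i" using i(1) by auto
    then show ?thesis unfolding island_orbit[OF isl] i(2) by simp
  qed
  then have "(F ^^ k) x = (F ^^ (k + (i - 1))) (z 1 \<theta>)" for k
    by (simp only: funpow_add o_apply)
  then show thesis by (intro that) (simp only: island_orbit[OF isl])
qed

lemma island_funpow_in:
  assumes isl: "island_dynamics M X A F X\<^sub>0 \<omega> \<mu> p z" and "x \<in> X\<^sub>0"
  shows "(F ^^ k) x \<in> X\<^sub>0"
proof -
  obtain j \<theta> where "(F ^^ k) x = z (Suc ((k + j) mod p)) (\<theta> + real ((k + j) div p) *\<^sub>R \<omega>)"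
    using island_points[OF assms] by metis
  moreover have p: "p \<ge> 1" using isl by (simp add: island_dynamics_def)
  then have "(k + j) mod p < p" by simp
  then have "Suc ((k + j) mod p) \<in> {1..p}" by simp
  ultimately show ?thesis using isl unfolding island_dynamics_def by blast
qed

lemma weighted_birkhoff_limit:
  fixes X :: "'x topology" and A :: "('x, 'e::euclidean_space) chart set"
    and z :: "nat \<Rightarrow> real ^ 'd \<Rightarrow> 'x" and h :: "'x \<Rightarrow> real ^ 'D"
  assumes w: "smooth_bump w" and dio: "diophantine c \<nu> \<omega>"
    and X: "Ck_manifold M X A" and isl: "island_dynamics M X A F X\<^sub>0 \<omega> \<mu> p z"
    and h: "Ck_map M X A euclidean std_atlas h"
    and m: "ereal_of_enat M > ereal (real CARD('d) + real m * \<nu>)"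
  shows "\<exists>C L. \<forall>N\<ge>1. \<forall>x\<in>X\<^sub>0. norm (WB w F N h x - L) \<le> C / real N ^ m"
proof -
  have p: "p \<ge> 1" using isl by (simp add: island_dynamics_def)
  \<comment> \<open>Fourier decay needs a finite order: M itself if it is finite, any large enough k
    if M = \<infinity>.\<close>
  obtain k where k: "enat k \<le> M" "real CARD('d) + real m * \<nu> < real k"
  proof (cases M)
    case (enat k)
    then show ?thesis using m by (intro that[of k]) auto
  next
    case infinity
    obtain k where "real CARD('d) + real m * \<nu> < real k" using reals_Archimedean2 by blast
    then show ?thesis using infinity by (intro that[of k]) auto
  qed
  have z: "torus_Ck_map M X A (z (Suc s))" if "s < p" for s
    using isl that by (auto simp: island_dynamics_def)
  define f where "f l s \<theta> = complex_of_real (h (z (Suc s) \<theta>) $ l)" for l s \<theta>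
  have per: "torus_periodic (f l s)" if "s < p" for l s
    using z[OF that] by (simp add: f_def torus_periodic_def torus_Ck_map_def)
  have Cn: "Cn_on k UNIV (f l s)" if "s < p" for l s
  proof -
    have "Cn_on k UNIV (\<lambda>\<theta>. h (z (Suc s) \<theta>))"
      using z[OF that] by (intro Cn_on_observable_compose[OF X h _ k(1)]) (simp add: torus_Ck_map_def)
    then show ?thesis
      unfolding f_def
      by (intro Cn_on_bounded_linear[where L = "\<lambda>v. complex_of_real (v $ l)"]
            bounded_linear_compose[OF bounded_linear_of_real bounded_linear_vec_nth]) auto
  qed
  define P where "P l C L \<longleftrightarrow> (\<forall>N\<ge>1. \<forall>j \<theta>. norm ((\<Sum>i<N. of_real (bump_weight w N i) *
      f l ((i + j) mod p) (\<theta> + real ((i + j) div p) *\<^sub>R \<omega>)) - L) \<le> C / real N ^ m)" for l C L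
  have "\<forall>l. \<exists>C L. P l C L"
    unfolding P_def by (intro allI island_average_scalar[OF w dio p per Cn k(2)])
  then obtain C L where "\<And>l. P l (C l) (L l)" by metis
  then have CL: "norm ((\<Sum>i<N. of_real (bump_weight w N i) *
      f l ((i + j) mod p) (\<theta> + real ((i + j) div p) *\<^sub>R \<omega>)) - L l) \<le> C l / real N ^ m"
    if "N \<ge> 1" for l N j \<theta>
    using that unfolding P_def by blast
  \<comment> \<open>The averages are real while the Fourier argument yields complex limits
    \<open>L l\<close>; passing to real parts can only shrink the error.\<close>
  have "norm (WB w F N h x - (\<chi> l. Re (L l))) \<le> (\<Sum>l\<in>UNIV. C l) / real N ^ m"
    if N: "N \<ge> 1" and x: "x \<in> X\<^sub>0" for N x
  proof -
    obtain j \<theta> where orb: "\<And>k. (F ^^ k) x = z (Suc ((k + j) mod p)) (\<theta> + real ((k + j) div p) *\<^sub>R \<omega>)"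
      using island_points[OF isl x] by metis
    have "norm (WB w F N h x - (\<chi> l. Re (L l))) \<le> (\<Sum>l\<in>UNIV. \<bar>(WB w F N h x - (\<chi> l. Re (L l))) $ l\<bar>)"
      by (rule norm_le_l1_cart)
    also have "\<dots> \<le> (\<Sum>l\<in>UNIV. C l / real N ^ m)"
    proof (rule sum_mono)
      fix l
      have "complex_of_real (WB w F N h x $ l) = (\<Sum>i<N. of_real (bump_weight w N i) *
          f l ((i + j) mod p) (\<theta> + real ((i + j) div p) *\<^sub>R \<omega>))"
        unfolding WB_def f_def orb by simp
      then have "norm (complex_of_real (WB w F N h x $ l) - L l) \<le> C l / real N ^ m"
        using CL[OF N, of l j \<theta>] by simp
      moreover have "\<bar>(WB w F N h x - (\<chi> l. Re (L l))) $ l\<bar> \<le> norm (complex_of_real (WB w F N h x $ l) - L l)"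
        using abs_Re_le_cmod[of "complex_of_real (WB w F N h x $ l) - L l"] by simp
      ultimately show "\<bar>(WB w F N h x - (\<chi> l. Re (L l))) $ l\<bar> \<le> C l / real N ^ m" by linarith
    qed
    finally show ?thesis by (simp add: sum_divide_distrib)
  qed
  then show ?thesis by blast
qed

section \<open>Invariance of the measure and the value of the limit\<close>

lemma sets_space_borel_of:
  assumes "sets \<mu> = sets (borel_of X)"
  shows "openin X U \<Longrightarrow> U \<in> sets \<mu>" and "space \<mu> = topspace X"
proof -
  have sub: "{U. openin X U} \<subseteq> Pow (topspace X)" using openin_subset by blast
  show "space \<mu> = topspace X"
    using sets_eq_imp_space_eq[OF assms] by (simp add: borel_of_def space_measure_of[OF sub])
  show "U \<in> sets \<mu>" if "openin X U"
    unfolding assms borel_of_def sets_measure_of[OF sub] using that by (intro sigma_sets.Basic) simp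
qed

lemma set_integral_WB:
  fixes h :: "'x \<Rightarrow> 'v::euclidean_space"
  assumes inv: "invariant_prob X F X\<^sub>0 \<mu>" and F: "continuous_map X X F" and h: "continuous_map X euclidean h"
    and FX: "\<And>k x. x \<in> X\<^sub>0 \<Longrightarrow> (F ^^ k) x \<in> X\<^sub>0"
    and bdd: "\<And>x. x \<in> X\<^sub>0 \<Longrightarrow> norm (h x) \<le> B"
    and w: "smooth_bump w" and N: "N \<ge> 1"
    and L: "\<And>x. x \<in> X\<^sub>0 \<Longrightarrow> norm (WB w F N h x - L) \<le> C"
  shows "norm ((LINT y:X\<^sub>0|\<mu>. h y) - L) \<le> C"
proof -
  have sets: "sets \<mu> = sets (borel_of X)" and e1: "emeasure \<mu> (space \<mu>) = 1"
    and eX: "emeasure \<mu> X\<^sub>0 = 1" and d: "distr \<mu> \<mu> F = \<mu>"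
    using inv by (auto simp: invariant_prob_def)
  note sp = sets_space_borel_of(2)[OF sets] and op = sets_space_borel_of(1)[OF sets]
  interpret finite_measure \<mu> by (rule finite_measureI) (simp add: e1)
  \<comment> \<open>\<open>emeasure\<close> is 0 on non-measurable sets, so the value 1 forces
    measurability.\<close>
  have X0: "X\<^sub>0 \<in> sets \<mu>" using eX emeasure_neq_0_sets by force
  have Fm: "F \<in> measurable \<mu> \<mu>"
  proof -
    have "F \<in> measurable \<mu> (borel_of X)"
      unfolding borel_of_def
    proof (rule measurable_measure_of)
      show "{U. openin X U} \<subseteq> Pow (topspace X)" using openin_subset by blast
      show "F \<in> space \<mu> \<rightarrow> topspace X" using F by (auto simp: sp continuous_map_def)
      fix U assume "U \<in> {U. openin X U}"
      then have "openin X {x \<in> topspace X. F x \<in> U}" using F by (auto simp: continuous_map_def)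
      moreover have "F -` U \<inter> space \<mu> = {x \<in> topspace X. F x \<in> U}" by (auto simp: sp)
      ultimately show "F -` U \<inter> space \<mu> \<in> sets \<mu>" using op by simp
    qed
    then show ?thesis by (simp only: measurable_cong_sets[OF refl sets])
  qed
  have hm: "h \<in> borel_measurable \<mu>"
  proof (rule borel_measurableI)
    fix S :: "'v set" assume "open S"
    then have "openin X {x \<in> topspace X. h x \<in> S}" using h by (auto simp: continuous_map_def)
    moreover have "h -` S \<inter> space \<mu> = {x \<in> topspace X. h x \<in> S}" by (auto simp: sp)
    ultimately show "h -` S \<inter> space \<mu> \<in> sets \<mu>" using op by simp
  qed
  \<comment> \<open>\<open>h\<close> is known to be bounded only on \<open>X\<^sub>0\<close>, so
    integrability is claimed for its cut-off; along orbits that start in the forward invariant set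
    \<open>X\<^sub>0\<close> the two agree, and the complement is null.\<close>
  define g where "g x = indicator X\<^sub>0 x *\<^sub>R h x" for x
  have gm: "g \<in> borel_measurable \<mu>" unfolding g_def using hm X0 by measurable
  have Fk: "(F ^^ k) \<in> measurable \<mu> \<mu> \<and> distr \<mu> \<mu> (F ^^ k) = \<mu>" for k
  proof (induction k)
    case 0
    then show ?case by (simp add: id_def distr_id)
  next
    case (Suc k)
    then have "distr \<mu> \<mu> (F \<circ> (F ^^ k)) = distr (distr \<mu> \<mu> (F ^^ k)) \<mu> F"
      by (intro distr_distr[symmetric] Fm) auto
    then have "distr \<mu> \<mu> (F \<circ> (F ^^ k)) = \<mu>" using Suc d by simp
    then show ?case unfolding funpow.simps(2) using Suc Fm measurable_comp by blast
  qed
  have gb: "norm (g x) \<le> \<bar>B\<bar>" for x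
    using bdd[of x] by (auto simp: g_def indicator_def)
  have gi: "integrable \<mu> (\<lambda>x. g ((F ^^ k) x))" for k
  proof (rule integrable_const_bound)
    show "(\<lambda>x. g ((F ^^ k) x)) \<in> borel_measurable \<mu>"
      using measurable_compose[of "F ^^ k" \<mu> \<mu> g borel] Fk gm by blast
  qed (use gb in auto)
  have gk: "(\<integral>x. g ((F ^^ k) x) \<partial>\<mu>) = integral\<^sup>L \<mu> g" for k
    using integral_distr[of "F ^^ k" \<mu> \<mu> g] Fk gm by simp
  define G where "G x = (\<Sum>k<N. bump_weight w N k *\<^sub>R g ((F ^^ k) x))" for x
  have Gi: "integrable \<mu> G" unfolding G_def using gi by auto
  have "integral\<^sup>L \<mu> G = (\<Sum>k<N. bump_weight w N k *\<^sub>R integral\<^sup>L \<mu> g)"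
    unfolding G_def using gi gk by simp
  also have "\<dots> = integral\<^sup>L \<mu> g"
    using sum_bump_weight[OF w N] by (simp flip: scaleR_sum_left)
  finally have "integral\<^sup>L \<mu> G = integral\<^sup>L \<mu> g" .
  moreover have m1: "measure \<mu> (space \<mu>) = 1" using e1 by (simp add: measure_def)
  ultimately have "integral\<^sup>L \<mu> g - L = (\<integral>x. G x - L \<partial>\<mu>)"
    using Gi by simp
  also have "norm \<dots> \<le> (\<integral>x. norm (G x - L) \<partial>\<mu>)" by (rule integral_norm_bound)
  also have "\<dots> \<le> (\<integral>x. C \<partial>\<mu>)"
  proof (rule integral_mono_AE)
    have "emeasure \<mu> (space \<mu> - X\<^sub>0) = 0"
      using emeasure_compl[OF X0] eX e1 by simp
    moreover have "norm (G x - L) \<le> C" if "x \<in> X\<^sub>0" for x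
    proof -
      have "G x = WB w F N h x" unfolding G_def WB_def g_def using FX[OF that] by simp
      then show ?thesis using L[OF that] by simp
    qed
    then have "{x \<in> space \<mu>. \<not> norm (G x - L) \<le> C} \<subseteq> space \<mu> - X\<^sub>0" by blast
    ultimately show "AE x in \<mu>. norm (G x - L) \<le> C"
      using X0 by (intro AE_I[of \<mu> _ "space \<mu> - X\<^sub>0"]) auto
  qed (use Gi in auto)
  also have "\<dots> = C" using m1 by simp
  finally show ?thesis by (simp add: g_def[abs_def] set_lebesgue_integral_def)
qed

theorem weighted_birkhoff_average:
  fixes X :: "'x topology" and A :: "('x, 'e::euclidean_space) chart set"
    and z :: "nat \<Rightarrow> real ^ 'd \<Rightarrow> 'x" and h :: "'x \<Rightarrow> real ^ 'D"
  assumes w: "smooth_bump w" and dio: "diophantine c \<nu> \<omega>"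
    and X: "Ck_manifold M X A" and F: "Ck_map M X A X A F"
    and isl: "island_dynamics M X A F X\<^sub>0 \<omega> \<mu> p z"
    and h: "Ck_map M X A euclidean std_atlas h"
    and m: "ereal_of_enat M > ereal (real CARD('d) + real m * \<nu>)"
  obtains C where "\<And>N x. N \<ge> 1 \<Longrightarrow> x \<in> X\<^sub>0 \<Longrightarrow>
    norm (WB w F N h x - (LINT y:X\<^sub>0|\<mu>. h y)) \<le> C / real N ^ m"
proof -
  obtain C L where CL: "\<And>N x. N \<ge> 1 \<Longrightarrow> x \<in> X\<^sub>0 \<Longrightarrow> norm (WB w F N h x - L) \<le> C / real N ^ m"
    using weighted_birkhoff_limit[OF w dio X isl h m] by blast
  have "\<exists>B. \<forall>x\<in>X\<^sub>0. norm (h x) \<le> B"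
  proof -
    have "bounded (h ` range (z j))" if "j \<in> {1..p}" for j
    proof -
      have z: "torus_Ck_map M X A (z j)" using isl that by (auto simp: island_dynamics_def)
      then have "Cn_on 0 UNIV (\<lambda>\<theta>. h (z j \<theta>))"
        by (intro Cn_on_observable_compose[OF X h]) (auto simp: torus_Ck_map_def zero_enat_def[symmetric])
      moreover have "torus_periodic (\<lambda>\<theta>. h (z j \<theta>))"
        using z by (simp add: torus_Ck_map_def torus_periodic_def)
      ultimately show ?thesis using torus_periodic_bounded by (simp add: image_image)
    qed
    then have "bounded (\<Union>j\<in>{1..p}. h ` range (z j))" by (intro bounded_UN) auto
    moreover have "h ` X\<^sub>0 = (\<Union>j\<in>{1..p}. h ` range (z j))"
      using isl by (auto simp: island_dynamics_def)
    ultimately have "bounded (h ` X\<^sub>0)" by (simp only:)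
    then show ?thesis by (auto simp: bounded_iff)
  qed
  then obtain B where B: "\<And>x. x \<in> X\<^sub>0 \<Longrightarrow> norm (h x) \<le> B" by blast
  \<comment> \<open>For the same N both the average and the integral lie within C / N^m of
    \<open>L\<close>; going through \<open>L\<close> doubles the constant.\<close>
  have "norm (WB w F N h x - (LINT y:X\<^sub>0|\<mu>. h y)) \<le> (2 * C) / real N ^ m" if N: "N \<ge> 1" and x: "x \<in> X\<^sub>0" for N x
  proof -
    have "norm ((LINT y:X\<^sub>0|\<mu>. h y) - L) \<le> C / real N ^ m"
      by (rule set_integral_WB[where B = B and w = w and N = N and F = F and X = X])
        (use isl F h B w N CL island_funpow_in[OF isl] in \<open>auto simp: island_dynamics_def Ck_map_def\<close>)
    then show ?thesis
      using CL[OF N x] norm_triangle_ineq4[of "WB w F N h x - L" "(LINT y:X\<^sub>0|\<mu>. h y) - L"] by simp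
  qed
  then show thesis by (rule that)
qed

section \<open>The least-squares problem\<close>

text \<open>Eliminating one column at a time by orthogonal projection needs no rank assumption.\<close>

lemma least_squares_attained:
  fixes b :: "'r \<Rightarrow> real" and A :: "nat \<Rightarrow> 'r \<Rightarrow> real"
  shows "\<exists>y. \<forall>y'. (\<Sum>r\<in>R. (b r + (\<Sum>k<n. y k * A k r))\<^sup>2) \<le> (\<Sum>r\<in>R. (b r + (\<Sum>k<n. y' k * A k r))\<^sup>2)"
proof (cases "finite R")
  case fin: True
  show ?thesis
  proof (induction n arbitrary: b A)
    case (Suc n)
    let ?a = "A n"
    let ?dot = "\<lambda>v. \<Sum>r\<in>R. v r * ?a r"
    define q where "q = (\<Sum>r\<in>R. (?a r)\<^sup>2)"
    show ?case
    proof (cases "q = 0")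
      case True
      then have "?a r = 0" if "r \<in> R" for r
        using that fin by (simp add: q_def sum_nonneg_eq_0_iff)
      then have "(\<Sum>r\<in>R. (b r + (\<Sum>k<Suc n. y k * A k r))\<^sup>2) = (\<Sum>r\<in>R. (b r + (\<Sum>k<n. y k * A k r))\<^sup>2)" for y
        by (intro sum.cong) auto
      with Suc[of b A] show ?thesis by simp
    next
      case False
      then have q: "q > 0" using sum_nonneg[of R "\<lambda>r. (?a r)\<^sup>2"] by (simp add: q_def)
      define P where "P v r = v r - ?dot v / q * ?a r" for v r
      have split: "(\<Sum>r\<in>R. (v r + t * ?a r)\<^sup>2) = (\<Sum>r\<in>R. (P v r)\<^sup>2) + (t + ?dot v / q)\<^sup>2 * q" for v t
      proof -
        define s where "s = ?dot v / q"
        have orth: "(\<Sum>r\<in>R. P v r * ?a r) = 0"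
        proof -
          have "(\<Sum>r\<in>R. P v r * ?a r) = ?dot v - s * q"
            by (simp add: P_def s_def q_def left_diff_distrib sum_subtractf sum_distrib_left power2_eq_square mult.assoc)
          then show ?thesis using q by (simp add: s_def)
        qed
        have "(v r + t * ?a r)\<^sup>2 = (P v r)\<^sup>2 + (2 * (t + s) * (P v r * ?a r) + (t + s)\<^sup>2 * (?a r)\<^sup>2)" for r
          by (simp add: P_def s_def[symmetric] power2_eq_square algebra_simps)
        then have "(\<Sum>r\<in>R. (v r + t * ?a r)\<^sup>2)
            = (\<Sum>r\<in>R. (P v r)\<^sup>2) + (2 * (t + s) * (\<Sum>r\<in>R. P v r * ?a r) + (t + s)\<^sup>2 * q)"
          by (simp add: sum.distrib sum_distrib_left q_def)
        then show ?thesis by (simp add: orth s_def)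
      qed
      define v where "v y r = b r + (\<Sum>k<n. y k * A k r)" for y r
      have dotv: "?dot (v y) = ?dot b + (\<Sum>k<n. y k * ?dot (A k))" for y
      proof -
        have "?dot (v y) = ?dot b + (\<Sum>r\<in>R. \<Sum>k<n. y k * A k r * ?a r)"
          by (simp add: v_def distrib_right sum.distrib sum_distrib_right)
        also have "(\<Sum>r\<in>R. \<Sum>k<n. y k * A k r * ?a r) = (\<Sum>k<n. y k * ?dot (A k))"
          by (subst sum.swap) (simp add: sum_distrib_left mult.assoc)
        finally show ?thesis .
      qed
      have Pv: "P (v y) r = P b r + (\<Sum>k<n. y k * P (A k) r)" for y r
      proof -
        define \<delta> where "\<delta> k = ?dot (A k)" for k
        define \<beta> where "\<beta> = ?dot b"
        show ?thesis
          unfolding P_def dotv \<delta>_def[symmetric] \<beta>_def[symmetric]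
          by (simp add: v_def right_diff_distrib sum_subtractf add_divide_distrib distrib_left distrib_right
              sum_divide_distrib sum_distrib_left sum_distrib_right mult_ac)
      qed
      obtain y where y: "\<And>y'. (\<Sum>r\<in>R. (P (v y) r)\<^sup>2) \<le> (\<Sum>r\<in>R. (P (v y') r)\<^sup>2)"
        using Suc[of "P b" "\<lambda>k. P (A k)"] unfolding Pv by blast
      have ex: "(\<Sum>r\<in>R. (b r + (\<Sum>k<Suc n. y k * A k r))\<^sup>2) = (\<Sum>r\<in>R. (v y r + y n * ?a r)\<^sup>2)" for y
        by (simp add: v_def add.assoc)
      \<comment> \<open>The last coefficient cancels the component along \<open>A n\<close>, which
        leaves only the orthogonal part that the induction hypothesis minimises.\<close>
      define y1 where "y1 = y(n := - (?dot (v y) / q))"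
      have vy1: "v y1 = v y" by (auto simp: v_def y1_def)
      have "(\<Sum>r\<in>R. (v y1 r + y1 n * ?a r)\<^sup>2) \<le> (\<Sum>r\<in>R. (v y' r + y' n * ?a r)\<^sup>2)" for y'
      proof -
        have "(\<Sum>r\<in>R. (v y1 r + y1 n * ?a r)\<^sup>2) = (\<Sum>r\<in>R. (P (v y) r)\<^sup>2)"
          unfolding split vy1 by (simp add: y1_def)
        also have "\<dots> \<le> (\<Sum>r\<in>R. (P (v y') r)\<^sup>2)" by (rule y)
        also have "\<dots> \<le> (\<Sum>r\<in>R. (v y' r + y' n * ?a r)\<^sup>2)" unfolding split using q by simp
        finally show ?thesis .
      qed
      then show ?thesis unfolding ex by blast
    qed
  qed simp
qed simp

lemma sum_symmetric_split:
  fixes g :: "nat \<Rightarrow> 'a::ab_group_add"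
  shows "(\<Sum>k\<le>2 * K. g k) = g K + (\<Sum>j<K. g (K + 1 + j) + g (K - 1 - j))"
proof -
  have "{..2 * K} = insert K ({..<K} \<union> {K<..2 * K})" by auto
  moreover have "{..<K} \<inter> {K<..2 * K} = {}" by auto
  ultimately have "(\<Sum>k\<le>2 * K. g k) = g K + (sum g {..<K} + sum g {K<..2 * K})"
    by (simp add: sum.union_disjoint)
  moreover have "sum g {K<..2 * K} = (\<Sum>j<K. g (K + 1 + j))"
    by (rule sum.reindex_bij_witness[of _ "\<lambda>j. K + 1 + j" "\<lambda>k. k - (K + 1)"]) auto
  moreover have "sum g {..<K} = (\<Sum>j<K. g (K - 1 - j))"
    by (rule sum.reindex_bij_witness[of _ "\<lambda>j. K - 1 - j" "\<lambda>k. K - 1 - k"]) auto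
  ultimately show ?thesis by (simp add: sum.distrib add.commute)
qed

text \<open>A symmetric vector with sum 1 is determined by its entries above K, and these are free:
  the middle entry is 1 minus twice their sum. Substituting this turns the constrained problem into
  an unconstrained one in K variables.\<close>

lemma feasible_row:
  assumes c: "c \<in> rre_feasible K"
  shows "(\<Sum>k\<le>2 * K. r k * c k) = r K + (\<Sum>j<K. c (K + 1 + j) * (r (K + 1 + j) + r (K - 1 - j) - 2 * r K))"
proof -
  have sym: "c (K - 1 - j) = c (K + 1 + j)" if "j < K" for j
  proof -
    have "j + 1 \<in> {1..K}" using that by auto
    then have "c (K + (j + 1)) - c (K - (j + 1)) = 0" using c unfolding rre_feasible_def by blast
    then show ?thesis by (simp add: algebra_simps)
  qed
  have "1 = c K + (\<Sum>j<K. c (K + 1 + j) + c (K - 1 - j))"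
    using c unfolding rre_feasible_def by (simp add: sum_symmetric_split)
  also have "(\<Sum>j<K. c (K + 1 + j) + c (K - 1 - j)) = (\<Sum>j<K. 2 * c (K + 1 + j))"
    by (rule sum.cong) (simp_all only: lessThan_iff sym mult_2)
  finally have cK: "c K = 1 - (\<Sum>j<K. 2 * c (K + 1 + j))" by simp
  have "(\<Sum>k\<le>2 * K. r k * c k) = r K * c K + (\<Sum>j<K. c (K + 1 + j) * (r (K + 1 + j) + r (K - 1 - j)))"
    unfolding sum_symmetric_split by (intro arg_cong2[of _ _ _ _ "(+)"] refl sum.cong) (simp_all only: lessThan_iff sym, simp add: algebra_simps)
  also have "\<dots> = r K + (\<Sum>j<K. c (K + 1 + j) * (r (K + 1 + j) + r (K - 1 - j) - 2 * r K))"
    unfolding cK by (simp add: algebra_simps sum_subtractf sum.distrib sum_distrib_left)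
  finally show ?thesis .
qed

text \<open>\<open>rre_residual_sq\<close> is a \<open>LEAST\<close> over the reals, about which
  something can be concluded only once the minimum is known to be attained. The minimiser is rebuilt
  from the free half by reflection in K.\<close>

lemma rre_minimum_attained:
  obtains c where "c \<in> rre_feasible K"
    "rre_residual_sq w F h x\<^sub>0 K T \<epsilon> = rre_objective w F h x\<^sub>0 K T \<epsilon> c"
    "\<And>c'. c' \<in> rre_feasible K \<Longrightarrow> rre_objective w F h x\<^sub>0 K T \<epsilon> c \<le> rre_objective w F h x\<^sub>0 K T \<epsilon> c'"
proof -
  let ?M = "rre_matrix w F h x\<^sub>0 K T \<epsilon>" and ?R = "({..<T} \<times> UNIV) <+> {..2 * K}"
  define Q where "Q y = (\<Sum>r\<in>?R. (?M r K + (\<Sum>j<K. y j * (?M r (K + 1 + j) + ?M r (K - 1 - j) - 2 * ?M r K)))\<^sup>2)" for y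
  have obj: "rre_objective w F h x\<^sub>0 K T \<epsilon> c = Q (\<lambda>j. c (K + 1 + j))" if "c \<in> rre_feasible K" for c
    unfolding rre_objective_def Q_def feasible_row[OF that] ..
  obtain y where y: "\<And>y'. Q y \<le> Q y'"
    using least_squares_attained[where R = ?R and n = K and b = "\<lambda>r. ?M r K"
        and A = "\<lambda>j r. ?M r (K + 1 + j) + ?M r (K - 1 - j) - 2 * ?M r K"]
    unfolding Q_def by blast
  define c where "c k = (if k = K then 1 - (\<Sum>j<K. 2 * y j) else if k < K then y (K - 1 - k) else y (k - K - 1))" for k
  have "(\<Sum>k\<le>2 * K. c k) = 1"
  proof -
    have "(\<Sum>j<K. c (K + 1 + j) + c (K - 1 - j)) = (\<Sum>j<K. 2 * y j)"
      by (rule sum.cong) (auto simp: c_def)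
    then show ?thesis unfolding sum_symmetric_split by (simp add: c_def)
  qed
  moreover have "c (K + k) - c (K - k) = 0" if "k \<in> {1..K}" for k
    using that by (auto simp: c_def)
  ultimately have c: "c \<in> rre_feasible K" by (simp add: rre_feasible_def)
  have Qc: "rre_objective w F h x\<^sub>0 K T \<epsilon> c = Q y"
    unfolding obj[OF c] by (simp add: c_def)
  have le: "rre_objective w F h x\<^sub>0 K T \<epsilon> c \<le> rre_objective w F h x\<^sub>0 K T \<epsilon> c'" if "c' \<in> rre_feasible K" for c'
    unfolding Qc obj[OF that] by (rule y)
  have "rre_residual_sq w F h x\<^sub>0 K T \<epsilon> = rre_objective w F h x\<^sub>0 K T \<epsilon> c"
    unfolding rre_residual_sq_def by (rule Least_equality) (use c le in auto)
  with c le show thesis using that by blast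
qed

section \<open>The objective at the trial vector and the bounds on the residual\<close>

definition rre_weight :: "(real \<Rightarrow> real) \<Rightarrow> nat \<Rightarrow> nat \<Rightarrow> real" where
  "rre_weight w K k = (bump_weight w (2 * K + 1) k + bump_weight w (2 * K + 1) (2 * K - k)) / 2"

lemma rre_objective_eq:
  fixes h :: "'x \<Rightarrow> real ^ 'D"
  assumes w: "smooth_bump w" and \<epsilon>: "\<epsilon> \<ge> 0"
  shows "rre_objective w F h x\<^sub>0 K T \<epsilon> c =
    (\<Sum>t<T. bump_weight w T t * (norm (\<Sum>k\<le>2 * K. c k *\<^sub>R rre_diff F h x\<^sub>0 (t + k)))\<^sup>2)
    + \<epsilon> * (\<Sum>k\<le>2 * K. (c k)\<^sup>2 / rre_weight w K k)"
proof -
  let ?M = "rre_matrix w F h x\<^sub>0 K T \<epsilon>"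
  let ?s = "\<lambda>t. \<Sum>k\<le>2 * K. c k *\<^sub>R rre_diff F h x\<^sub>0 (t + k)"
  \<comment> \<open>Also valid at 0, since \<open>0 powr (1/2) = 0\<close>; this covers \<epsilon> =
    0.\<close>
  have sq: "(x powr (1/2))\<^sup>2 = x" if "x \<ge> 0" for x :: real
    using that by (simp add: powr_half_sqrt)
  have left: "(\<Sum>k\<le>2 * K. ?M (Inl (t, i)) k * c k)\<^sup>2 = bump_weight w T t * (?s t $ i)\<^sup>2" if "t < T" for t i
  proof -
    have "?M (Inl (t, i)) k = bump_weight w T t powr (1/2) * rre_diff F h x\<^sub>0 (t + k) $ i" for k
    proof -
      have "?M (Inl (t, i)) k = (\<Sum>j\<in>{..<T} \<times> UNIV. if (t, i) = j
          then bump_weight w T t powr (1/2) * rre_diff F h x\<^sub>0 (t + k) $ i else 0)"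
        unfolding rre_matrix_def rmat_mult_def old.sum.case
        by (rule sum.cong) (auto simp: diag_powr_def rre_WT_def rre_U_def)
      also have "\<dots> = bump_weight w T t powr (1/2) * rre_diff F h x\<^sub>0 (t + k) $ i"
        using that by (subst sum.delta') auto
      finally show ?thesis .
    qed
    then have "(\<Sum>k\<le>2 * K. ?M (Inl (t, i)) k * c k) = bump_weight w T t powr (1/2) * (?s t $ i)"
      by (simp add: sum_distrib_left mult_ac)
    then show ?thesis using sq[of "bump_weight w T t"] bump_weight_pos[OF w that]
      by (simp add: power_mult_distrib)
  qed
  have right: "(\<Sum>l\<le>2 * K. ?M (Inr k) l * c l)\<^sup>2 = \<epsilon> * ((c k)\<^sup>2 / rre_weight w K k)" if k: "k \<le> 2 * K" for k
  proof -
    \<comment> \<open>The nodes are interior points of [0,1], so both weights are positive.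
      Positivity matters because \<open>powr\<close> sends base 0 to 0 even for a negative
      exponent.\<close>
    have W: "rre_weight w K k > 0"
      unfolding rre_weight_def using bump_weight_pos[OF w, of k "2 * K + 1"] bump_weight_pos[OF w, of "2 * K - k" "2 * K + 1"] k
      by (simp add: less_Suc_eq_le)
    have "(\<Sum>l\<le>2 * K. ?M (Inr k) l * c l)
        = (\<Sum>l\<le>2 * K. if k = l then \<epsilon> powr (1/2) * rre_weight w K k powr (-1/2) * c k else 0)"
      by (rule sum.cong) (auto simp: rre_matrix_def diag_powr_def rre_WK_def rre_weight_def)
    also have "\<dots> = \<epsilon> powr (1/2) * rre_weight w K k powr (-1/2) * c k"
      using k by (subst sum.delta') auto
    finally have "(\<Sum>l\<le>2 * K. ?M (Inr k) l * c l) = \<epsilon> powr (1/2) * rre_weight w K k powr (-1/2) * c k" .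
    moreover have "(rre_weight w K k powr (-1/2))\<^sup>2 = 1 / rre_weight w K k"
    proof -
      have "rre_weight w K k powr (-1/2) = inverse (rre_weight w K k powr (1/2))"
        using powr_minus[of "rre_weight w K k" "1/2"] by simp
      then show ?thesis using sq[of "rre_weight w K k"] W by (simp add: inverse_eq_divide power_divide)
    qed
    ultimately show ?thesis using sq[OF \<epsilon>] by (simp add: power_mult_distrib)
  qed
  have "rre_objective w F h x\<^sub>0 K T \<epsilon> c
      = (\<Sum>(t, i)\<in>{..<T} \<times> UNIV. bump_weight w T t * (?s t $ i)\<^sup>2)
        + (\<Sum>k\<le>2 * K. \<epsilon> * ((c k)\<^sup>2 / rre_weight w K k))"
    unfolding rre_objective_def
    by (subst sum.Plus) (auto intro!: arg_cong2[of _ _ _ _ "(+)"] sum.cong simp: left right)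
  also have "(\<Sum>(t, i)\<in>{..<T} \<times> UNIV. bump_weight w T t * (?s t $ i)\<^sup>2)
      = (\<Sum>t<T. bump_weight w T t * (norm (?s t))\<^sup>2)"
  proof -
    have "(norm v)\<^sup>2 = (\<Sum>i\<in>UNIV. (v $ i)\<^sup>2)" for v :: "real ^ 'D"
      unfolding power2_norm_eq_inner inner_vec_def by (simp add: power2_eq_square)
    then show ?thesis by (simp only: sum_distrib_left sum.cartesian_product)
  qed
  finally show ?thesis by (simp add: sum_distrib_left)
qed

lemma smooth_bump_symmetrize:
  assumes w: "smooth_bump w"
  shows "smooth_bump (\<lambda>x. (w x + w (1 - x)) / 2)"
proof -
  have "Cn_on n UNIV (\<lambda>x. (w x + w (1 - x)) / 2)" for n
  proof -
    have wn: "Cn_on n UNIV w" using w by (simp add: smooth_bump_def Ck_on_def)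
    have "Cn_on n UNIV (\<lambda>x :: real. 1 - x)"
    proof (cases n)
      case (Suc n')
      show ?thesis unfolding Suc
        by (rule Cn_on_SucI[where f' = "\<lambda>_ v. - v"]) (auto intro!: derivative_eq_intros Cn_on_const)
    qed (auto intro!: continuous_intros)
    then have "Cn_on n UNIV (\<lambda>x. w (1 - x))"
      by (intro Cn_on_compose[OF _ _ wn]) auto
    then have "Cn_on n UNIV (\<lambda>x. w x + w (1 - x))" by (intro Cn_on_add wn) auto
    then show ?thesis by (rule Cn_on_bounded_linear[OF open_UNIV bounded_linear_divide])
  qed
  then show ?thesis using w by (auto simp: smooth_bump_def Ck_on_def intro!: add_pos_pos)
qed

text \<open>The nodes (j+1)/(N+1) are symmetric about 1/2, so reflecting the bump reverses the
  weights and keeps the normalising sum. For N = 2K + 1 the right-hand side is the diagonal of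
  W_K.\<close>

lemma bump_weight_symmetrize:
  assumes "k < N"
  shows "bump_weight (\<lambda>x. (w x + w (1 - x)) / 2) N k = (bump_weight w N k + bump_weight w N (N - 1 - k)) / 2"
proof -
  have refl: "1 - real (j + 1) / real (N + 1) = real (N - Suc j + 1) / real (N + 1)" if "j < N" for j
    using that by (simp add: field_simps)
  have "(\<Sum>j<N. w (1 - real (j + 1) / real (N + 1))) = (\<Sum>j<N. w (real (N - Suc j + 1) / real (N + 1)))"
    by (rule sum.cong) (simp_all only: refl lessThan_iff)
  also have "\<dots> = (\<Sum>j<N. w (real (j + 1) / real (N + 1)))"
    by (rule sum.nat_diff_reindex)
  finally have "(\<Sum>j<N. (w (real (j + 1) / real (N + 1)) + w (1 - real (j + 1) / real (N + 1))) / 2)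
      = (\<Sum>j<N. w (real (j + 1) / real (N + 1)))"
    by (simp add: sum.distrib flip: sum_divide_distrib)
  then show ?thesis unfolding bump_weight_def refl[OF assms] by (simp add: distrib_left)
qed

lemma rre_weight_eq:
  "k \<le> 2 * K \<Longrightarrow> rre_weight w K k = bump_weight (\<lambda>x. (w x + w (1 - x)) / 2) (2 * K + 1) k"
  by (subst bump_weight_symmetrize) (simp_all add: rre_weight_def)

lemma rre_weight_sum_WB:
  "(\<Sum>k\<le>2 * K. rre_weight w K k *\<^sub>R rre_diff F h x\<^sub>0 (t + k)) =
    WB (\<lambda>x. (w x + w (1 - x)) / 2) F (2 * K + 1) h ((F ^^ (t + 1)) x\<^sub>0)
    - WB (\<lambda>x. (w x + w (1 - x)) / 2) F (2 * K + 1) h ((F ^^ t) x\<^sub>0)"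
proof -
  have orb: "(F ^^ k) ((F ^^ i) x\<^sub>0) = (F ^^ (i + k)) x\<^sub>0" for k i
    by (simp add: funpow_add[symmetric] add.commute flip: comp_apply[of "F ^^ k"])
  have set: "{..2 * K} = {..<2 * K + 1}" by auto
  show ?thesis
    unfolding WB_def orb set rre_diff_def sum_subtractf[symmetric] scaleR_diff_right[symmetric]
    by (rule sum.cong) (simp_all add: rre_weight_eq)
qed

text \<open>T enters only through nonnegative weights with sum 1, so a bound \<open>d\<close> common
  to all row blocks passes to their weighted sum unchanged. This is why the estimate does not depend
  on T.\<close>

theorem rre_residual_bounds:
  fixes h :: "'x \<Rightarrow> real ^ 'D"
  assumes w: "smooth_bump w" and \<epsilon>: "\<epsilon> \<ge> 0" and T: "T \<ge> 1"
    and osc: "\<And>t. norm (WB (\<lambda>x. (w x + w (1 - x)) / 2) F (2 * K + 1) h ((F ^^ (t + 1)) x\<^sub>0)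
      - WB (\<lambda>x. (w x + w (1 - x)) / 2) F (2 * K + 1) h ((F ^^ t) x\<^sub>0)) \<le> d"
  shows "\<epsilon> \<le> rre_residual_sq w F h x\<^sub>0 K T \<epsilon>" and "rre_residual_sq w F h x\<^sub>0 K T \<epsilon> \<le> \<epsilon> + d\<^sup>2"
proof -
  let ?v = "\<lambda>x. (w x + w (1 - x)) / 2" and ?W = "rre_weight w K"
  have sv: "smooth_bump ?v" by (rule smooth_bump_symmetrize[OF w])
  have set: "{..2 * K} = {..<2 * K + 1}" by auto
  have W0: "?W k > 0" if "k \<le> 2 * K" for k
    unfolding rre_weight_eq[OF that] using that by (intro bump_weight_pos[OF sv]) simp
  have W1: "(\<Sum>k\<le>2 * K. ?W k) = 1"
  proof -
    have "(\<Sum>k\<le>2 * K. ?W k) = (\<Sum>k\<le>2 * K. bump_weight ?v (2 * K + 1) k)"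
      by (rule sum.cong) (auto simp: rre_weight_eq)
    then show ?thesis unfolding set using sum_bump_weight[OF sv, of "2 * K + 1"] by simp
  qed
  have wT: "bump_weight w T t \<ge> 0" if "t < T" for t using bump_weight_pos[OF w that] by simp
  obtain c where c: "c \<in> rre_feasible K"
    and res: "rre_residual_sq w F h x\<^sub>0 K T \<epsilon> = rre_objective w F h x\<^sub>0 K T \<epsilon> c"
    and min: "\<And>c'. c' \<in> rre_feasible K \<Longrightarrow> rre_objective w F h x\<^sub>0 K T \<epsilon> c \<le> rre_objective w F h x\<^sub>0 K T \<epsilon> c'"
    by (rule rre_minimum_attained[where K = K and w = w and F = F and h = h and x\<^sub>0 = x\<^sub>0 and T = T and \<epsilon> = \<epsilon>]) blast
  \<comment> \<open>Cauchy-Schwarz in expanded form: c and the diagonal of W_K both have sum 1, so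
    this nonnegative quantity is the penalty sum minus 1.\<close>
  have "0 \<le> (\<Sum>k\<le>2 * K. (c k - ?W k)\<^sup>2 / ?W k)"
    by (intro sum_nonneg divide_nonneg_nonneg) (auto simp: W0 less_imp_le)
  also have "\<dots> = (\<Sum>k\<le>2 * K. (c k)\<^sup>2 / ?W k - 2 * c k + ?W k)"
  proof (rule sum.cong[OF refl])
    fix k assume "k \<in> {..2 * K}"
    then have "?W k \<noteq> 0" using W0[of k] by simp
    then show "(c k - ?W k)\<^sup>2 / ?W k = (c k)\<^sup>2 / ?W k - 2 * c k + ?W k"
      by (simp add: field_simps power2_eq_square)
  qed
  also have "\<dots> = (\<Sum>k\<le>2 * K. (c k)\<^sup>2 / ?W k) - 2 * (\<Sum>k\<le>2 * K. c k) + (\<Sum>k\<le>2 * K. ?W k)"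
    by (simp add: sum.distrib sum_subtractf sum_distrib_left)
  also have "(\<Sum>k\<le>2 * K. c k) = 1" using c by (simp add: rre_feasible_def)
  finally have "\<epsilon> * 1 \<le> \<epsilon> * (\<Sum>k\<le>2 * K. (c k)\<^sup>2 / ?W k)" using W1 \<epsilon> by (intro mult_left_mono) auto
  moreover have "0 \<le> (\<Sum>t<T. bump_weight w T t * (norm (\<Sum>k\<le>2 * K. c k *\<^sub>R rre_diff F h x\<^sub>0 (t + k)))\<^sup>2)"
    by (intro sum_nonneg mult_nonneg_nonneg) (auto simp: wT)
  ultimately show "\<epsilon> \<le> rre_residual_sq w F h x\<^sub>0 K T \<epsilon>"
    unfolding res rre_objective_eq[OF w \<epsilon>] by simp
  have "?W \<in> rre_feasible K"
  proof -
    have "?W (K + k) = ?W (K - k)" if "k \<in> {1..K}" for k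
      using that by (simp add: rre_weight_def add.commute)
    then show ?thesis using W1 by (simp add: rre_feasible_def)
  qed
  then have "rre_residual_sq w F h x\<^sub>0 K T \<epsilon> \<le> rre_objective w F h x\<^sub>0 K T \<epsilon> ?W"
    unfolding res by (rule min)
  also have "\<dots> \<le> d\<^sup>2 + \<epsilon>"
    unfolding rre_objective_eq[OF w \<epsilon>]
  proof (rule add_mono)
    have "(\<Sum>k\<le>2 * K. (?W k)\<^sup>2 / ?W k) = (\<Sum>k\<le>2 * K. ?W k)"
      by (rule sum.cong) (auto simp: power2_eq_square)
    then show "\<epsilon> * (\<Sum>k\<le>2 * K. (?W k)\<^sup>2 / ?W k) \<le> \<epsilon>" using W1 by simp
    have "(\<Sum>t<T. bump_weight w T t * (norm (\<Sum>k\<le>2 * K. ?W k *\<^sub>R rre_diff F h x\<^sub>0 (t + k)))\<^sup>2)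
        \<le> (\<Sum>t<T. bump_weight w T t * d\<^sup>2)"
    proof (rule sum_mono)
      fix t assume "t \<in> {..<T}"
      then show "bump_weight w T t * (norm (\<Sum>k\<le>2 * K. ?W k *\<^sub>R rre_diff F h x\<^sub>0 (t + k)))\<^sup>2 \<le> bump_weight w T t * d\<^sup>2"
        unfolding rre_weight_sum_WB using osc[of t] wT[of t] by (intro mult_left_mono power_mono) auto
    qed
    also have "\<dots> = d\<^sup>2" using sum_bump_weight[OF w T] by (simp flip: sum_distrib_right)
    finally show "(\<Sum>t<T. bump_weight w T t * (norm (\<Sum>k\<le>2 * K. ?W k *\<^sub>R rre_diff F h x\<^sub>0 (t + k)))\<^sup>2) \<le> d\<^sup>2" .
  qed
  finally show "rre_residual_sq w F h x\<^sub>0 K T \<epsilon> \<le> \<epsilon> + d\<^sup>2" by simp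
qed

theorem mainTheorem1:
  fixes w :: "real \<Rightarrow> real"
    and M :: enat
    and X :: "'x topology"
    and A :: "('x, 'e::euclidean_space) chart set"
    and F :: "'x \<Rightarrow> 'x"
    and X\<^sub>0 :: "'x set"
    and \<mu> :: "'x measure"
    and p m :: nat
    and z :: "nat \<Rightarrow> real ^ 'd \<Rightarrow> 'x"
    and \<omega> :: "real ^ 'd"
    and c \<nu> :: real
    and h :: "'x \<Rightarrow> real ^ 'D"
  assumes "1 \<le> M"
    and H1: "smooth_bump w"
    and H2: "diophantine c \<nu> \<omega>"
    and H3: "Ck_manifold M X A"
      "Ck_map M X A X A F"
      "island_dynamics M X A F X\<^sub>0 \<omega> \<mu> p z"
      "Ck_map M X A euclidean std_atlas h"
    and m: "1 < m"
      "ereal_of_enat M > ereal (real CARD('d) + real m * \<nu>)"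
  shows "\<exists>C\<^sub>m.
    (\<forall>N\<ge>1. \<forall>x\<in>X\<^sub>0. norm (WB w F N h x - (LINT y:X\<^sub>0|\<mu>. h y)) \<le> C\<^sub>m / real N ^ m) \<and>
    (\<forall>x\<^sub>0\<in>X\<^sub>0. \<forall>K\<ge>1. \<forall>T\<ge>1. \<forall>\<epsilon>\<ge>0.
       \<epsilon> \<le> rre_residual_sq w F h x\<^sub>0 K T \<epsilon> \<and>
       rre_residual_sq w F h x\<^sub>0 K T \<epsilon> \<le> \<epsilon> + C\<^sub>m / real (2 * K) ^ (2 * m))"
proof -
  let ?v = "\<lambda>x. (w x + w (1 - x)) / 2" and ?I = "LINT y:X\<^sub>0|\<mu>. h y"
  obtain C where C: "\<And>N x. N \<ge> 1 \<Longrightarrow> x \<in> X\<^sub>0 \<Longrightarrow> norm (WB w F N h x - ?I) \<le> C / real N ^ m"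
    by (rule weighted_birkhoff_average[OF H1 H2 H3 m(2)]) blast
  obtain C' where C': "\<And>N x. N \<ge> 1 \<Longrightarrow> x \<in> X\<^sub>0 \<Longrightarrow> norm (WB ?v F N h x - ?I) \<le> C' / real N ^ m"
    by (rule weighted_birkhoff_average[OF smooth_bump_symmetrize[OF H1] H2 H3 m(2)]) blast
  \<comment> \<open>In the second entry, two averages with error at most C' / (2K)^m each are
    subtracted, and the norm is squared.\<close>
  define Cm where "Cm = max C ((2 * C')\<^sup>2)"
  have "norm (WB w F N h x - ?I) \<le> Cm / real N ^ m" if "N \<ge> 1" "x \<in> X\<^sub>0" for N x
  proof -
    have "C / real N ^ m \<le> Cm / real N ^ m" by (intro divide_right_mono) (auto simp: Cm_def)
    then show ?thesis using C[OF that] by linarith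
  qed
  moreover have "\<epsilon> \<le> rre_residual_sq w F h x\<^sub>0 K T \<epsilon> \<and>
      rre_residual_sq w F h x\<^sub>0 K T \<epsilon> \<le> \<epsilon> + Cm / real (2 * K) ^ (2 * m)"
    if x0: "x\<^sub>0 \<in> X\<^sub>0" and K: "K \<ge> 1" and T: "T \<ge> 1" and \<epsilon>: "\<epsilon> \<ge> 0" for x\<^sub>0 K T \<epsilon>
  proof -
    let ?d = "2 * C' / real (2 * K) ^ m"
    \<comment> \<open>The averages run over 2K + 1 terms; nonnegativity of \<open>C'\<close>, read
      off from N = 1, allows 2K + 1 to be replaced by 2K in the denominator.\<close>
    have C'0: "0 \<le> C'" using order_trans[OF norm_ge_zero C'[of 1 x\<^sub>0]] x0 by simp
    have "norm (WB ?v F (2 * K + 1) h ((F ^^ (t + 1)) x\<^sub>0) - WB ?v F (2 * K + 1) h ((F ^^ t) x\<^sub>0)) \<le> ?d" for t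
    proof -
      have b: "norm (WB ?v F (2 * K + 1) h ((F ^^ t) x\<^sub>0) - ?I) \<le> C' / real (2 * K + 1) ^ m" for t
        by (rule C') (auto intro: island_funpow_in[OF H3(3) x0])
      have "C' / real (2 * K + 1) ^ m \<le> C' / real (2 * K) ^ m"
        using C'0 K by (intro divide_left_mono power_mono mult_pos_pos zero_less_power) auto
      then show ?thesis
        using b[of t] b[of "t + 1"]
          norm_triangle_ineq4[of "WB ?v F (2 * K + 1) h ((F ^^ (t + 1)) x\<^sub>0) - ?I" "WB ?v F (2 * K + 1) h ((F ^^ t) x\<^sub>0) - ?I"]
        by simp
    qed
    note bounds = rre_residual_bounds[OF H1 \<epsilon> T this]
    have "?d\<^sup>2 = (2 * C')\<^sup>2 / real (2 * K) ^ (2 * m)"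
      by (simp only: power_divide power_mult[symmetric] mult.commute[of m])
    also have "\<dots> \<le> Cm / real (2 * K) ^ (2 * m)" by (intro divide_right_mono) (auto simp: Cm_def)
    finally show ?thesis using bounds by linarith
  qed
  ultimately show ?thesis by blast
qed

end
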